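(* Let $n,s,h\ge1$, let $\delta:\Sigma\times Q\to\Sigma\times Q\times\{\text{left},\text{right}\}$ be the transition function of a Turing machine with tape alphabet $\Sigma=\{0,\dots,s-1\}$ and states $Q=\{0,\dots,n-1\}$, and let $A$ be a formula. There is a component-wise plain proof $${}_h\underline{\mathrm{absstep}}:\;{!}{}_s\mathbf{bool}_A^{\otimes h}\otimes{!}{}_n\mathbf{bool}_A\otimes{!}{}_h\mathbf{bool}_A\;\vdash\;{!}{}_s\mathbf{bool}_A^{\otimes h}\otimes{!}{}_n\mathbf{bool}_A\otimes{!}{}_h\mathbf{bool}_A$$ which encodes a single transition step of the Turing machine using absolute tape coordinates. That is: for all $\sigma_0,\dots,\sigma_{h-1}\in\Sigma$, $q\in Q$ and $i\in\{0,\dots,h-1\}$, with $\delta(\sigma_i,q)=(\sigma_i',q',d)$, the cut of ${}_h\underline{\mathrm{absstep}}$ against $\mathrm{prom}(\underline{\sigma_0})\otimes\cdots\otimes\mathrm{prom}(\underline{\sigma_{h-1}})\otimes\mathrm{prom}(\underline{q})\otimes\mathrm{prom}(\underline{i})$ is equivalent under cut-elimination to $\mathrm{prom}(\underline{\rho_0})\otimes\cdots\otimes\mathrm{prom}(\underline{\rho_{h-1}})\otimes\mathrm{prom}(\underline{q'})\otimes\mathrm{prom}(\underline{i'})$, where $\rho_i=\sigma_i'$, $\rho_j=\sigma_j$ for $j\ne i$, and $i'\equiv i-1\pmod h$ if $d=\text{left}$, $i'\equiv i+1\pmod h$ if $d=\text{right}$.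
   Context: **Logic.** Linear logic means propositional intuitionistic linear logic with connectives $\otimes,\&,\multimap,!$, as a sequent calculus with one formula on the right: axiom, cut, exchange, left and right rules for $\otimes,\&,\multimap$, and dereliction, weakening, contraction and promotion (from $!\Gamma\vdash B$ infer $!\Gamma\vdash !B$) for $!$. Proofs are considered modulo *equivalence under cut-elimination*: the congruence generated by the standard cut-elimination transformations (including commuting conversions and $\eta$-expansion of axioms), with the structural rules taken up to the usual identities (contraction is associative and commutative, with weakening as unit). $\mathrm{prom}(\pi)$ is the proof obtained from $\pi$ by promotion. "$m\,B$" in a list of hypotheses means $m$ copies of $B$; ${!}B^{\otimes m}$ means $({!}B)^{\otimes m}$. A proof of $!A_1\otimes\cdots\otimes !A_r\vdash C$ is identified, via $\otimes L$, with a proof of $!A_1,\dots,!A_r\vdash C$. **Plain proofs.** A proof of $!A_1,\dots,!A_r\vdash B$ ($r\ge0$) is *plain* if it is equivalent under cut-elimination to one obtained from some proof $\pi$ of $n_1A_1,\dots,n_rA_r\vdash B$ (for some integers $n_i\ge 0$) by derelicting every hypothesis and then, for each $i$, contracting the $n_i$ copies of $!A_i$ into one (if $n_i>1$) or weakening in $!A_i$ (if $n_i=0$). A proof $\psi$ of $!A_1,\dots,!A_r\vdash !B_1\otimes\cdots\otimes !B_t$ is *component-wise plain* if there are plain proofs $\psi_i$ of $!A_1,\dots,!A_r\vdash B_i$ ($1\le i\le t$) such that $\psi$ is equivalent under cut-elimination to the proof obtained from $\bigotimes_{i=1}^t\mathrm{prom}(\psi_i)$, a proof of $t\,!A_1,\dots,t\,!A_r\vdash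 !B_1\otimes\cdots\otimes !B_t$, by contracting the $t$ copies of each $!A_j$. **Data.** ${}_m\mathbf{bool}_A=A^m\multimap A$ where $A^m=A\&\cdots\&A$; for $0\le i\le m-1$, $\underline{i}$ is the proof of ${}_m\mathbf{bool}_A$ given by projection onto the $i$-th coordinate (counted from $0$). The machine works on a region of $h$ tape squares with positions $\{0,\dots,h-1\}$ identified with $\mathbb{Z}/h\mathbb{Z}$; the $h$-boolean is the head position. *)

theory Defs
  imports Main
begin

section \<open>Formulas and sequent calculus proofs\<close>

datatype 'a form =
    Atom 'a
  | Tensor "'a form" "'a form" (infixl "\<otimes>" 75)
  | With "'a form" "'a form" (infixl "\<^bold>&" 75)
  | Lolli "'a form" "'a form" (infixr "\<multimap>" 70)
  | Bang "'a form" ("\<^bold>! _" [80] 80)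

text \<open>
  Hypotheses form a list, and exchange is an explicit rule. A natural number argument of a
  rule is the position (from 0) of the hypothesis on which the rule acts, i.e. the length of
  the part \<open>\<Upsilon>\<close> of the context to its left. A formula argument is the one that
  cannot be read off the premises, so that a proof determines its conclusion.
\<close>

datatype 'a deriv =
    Ax "'a form"
  | Cut nat "'a deriv" "'a deriv"
  | Exch nat "'a deriv"
  | TensR "'a deriv" "'a deriv"
  | TensL nat "'a deriv"
  | WithR "'a deriv" "'a deriv"
  | WithL1 nat "'a form" "'a deriv"
  | WithL2 nat "'a form" "'a deriv"
  | LolliR "'a deriv"
  | LolliL nat "'a deriv" "'a deriv"
  | Der nat "'a deriv"
  | Weak nat "'a form" "'a deriv"
  | Contr nat "'a deriv"
  | Prom "'a deriv"

text \<open>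
  \<open>left_rule L \<Theta> \<Theta>'\<close>: the rule \<open>L\<close> has a single premise
  \<open>\<Upsilon>, \<Theta>, \<Delta> \<turnstile> C\<close> and conclusion
  \<open>\<Upsilon>, \<Theta>', \<Delta> \<turnstile> C\<close>. These rules share their congruence and
  commuting conversions.
\<close>

inductive left_rule :: "(nat \<Rightarrow> 'a deriv \<Rightarrow> 'a deriv) \<Rightarrow> 'a form list \<Rightarrow> 'a form list \<Rightarrow> bool" where
  "left_rule Exch [A, B] [B, A]"
| "left_rule TensL [A, B] [A \<otimes> B]"
| "left_rule (\<lambda>k. WithL1 k B) [A] [A \<^bold>& B]"
| "left_rule (\<lambda>k. WithL2 k A) [B] [A \<^bold>& B]"
| "left_rule Der [A] [\<^bold>! A]"
| "left_rule (\<lambda>k. Weak k A) [] [\<^bold>! A]"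
| "left_rule Contr [\<^bold>! A, \<^bold>! A] [\<^bold>! A]"

inductive proves :: "'a deriv \<Rightarrow> 'a form list \<Rightarrow> 'a form \<Rightarrow> bool"
    ("_ \<triangleright> _ \<turnstile> _" [50, 50, 50] 50) where
  Ax: "Ax A \<triangleright> [A] \<turnstile> A"
| Cut: "p \<triangleright> \<Gamma> \<turnstile> A \<Longrightarrow> q \<triangleright> \<Upsilon> @ A # \<Delta> \<turnstile> C \<Longrightarrow>
    Cut (length \<Upsilon>) p q \<triangleright> \<Upsilon> @ \<Gamma> @ \<Delta> \<turnstile> C"
| Unary: "left_rule L \<Theta> \<Theta>' \<Longrightarrow> p \<triangleright> \<Upsilon> @ \<Theta> @ \<Delta> \<turnstile> C \<Longrightarrow>
    L (length \<Upsilon>) p \<triangleright> \<Upsilon> @ \<Theta>' @ \<Delta> \<turnstile> C"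
| TensR: "p \<triangleright> \<Gamma> \<turnstile> A \<Longrightarrow> q \<triangleright> \<Delta> \<turnstile> B \<Longrightarrow>
    TensR p q \<triangleright> \<Gamma> @ \<Delta> \<turnstile> A \<otimes> B"
| WithR: "p \<triangleright> \<Gamma> \<turnstile> A \<Longrightarrow> q \<triangleright> \<Gamma> \<turnstile> B \<Longrightarrow>
    WithR p q \<triangleright> \<Gamma> \<turnstile> A \<^bold>& B"
| LolliR: "p \<triangleright> A # \<Gamma> \<turnstile> B \<Longrightarrow> LolliR p \<triangleright> \<Gamma> \<turnstile> A \<multimap> B"
| LolliL: "p \<triangleright> \<Gamma> \<turnstile> A \<Longrightarrow> q \<triangleright> \<Upsilon> @ B # \<Delta> \<turnstile> C \<Longrightarrow>
    LolliL (length \<Upsilon>) p q \<triangleright> \<Upsilon> @ \<Gamma> @ (A \<multimap> B) # \<Delta> \<turnstile> C"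
| Prom: "p \<triangleright> map Bang \<Gamma> \<turnstile> A \<Longrightarrow> Prom p \<triangleright> map Bang \<Gamma> \<turnstile> \<^bold>! A"

subsection \<open>Derived structural rules\<close>

text \<open>
  \<open>exch_left k m\<close> moves the hypothesis at position \<open>k + m\<close> to position \<open>k\<close>;
  \<open>exch_right k m\<close> is its inverse.
\<close>

definition exch_left :: "nat \<Rightarrow> nat \<Rightarrow> 'a deriv \<Rightarrow> 'a deriv" where
  "exch_left k m p = fold Exch (rev [k..<k + m]) p"

definition exch_right :: "nat \<Rightarrow> nat \<Rightarrow> 'a deriv \<Rightarrow> 'a deriv" where
  "exch_right k m p = fold Exch [k..<k + m] p"

text \<open>From \<open>\<Upsilon>, \<Delta> \<turnstile> C\<close> to \<open>\<Upsilon>, !\<Gamma>, \<Delta> \<turnstile> C\<close>, with \<open>k\<close> the length of \<open>\<Upsilon>\<close>.\<close>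

definition weaken_all :: "nat \<Rightarrow> 'a form list \<Rightarrow> 'a deriv \<Rightarrow> 'a deriv" where
  "weaken_all k \<Gamma> p = foldr (Weak k) \<Gamma> p"

text \<open>
  From \<open>\<Upsilon>, !\<Gamma>, !\<Gamma>, \<Delta> \<turnstile> C\<close> to \<open>\<Upsilon>, !\<Gamma>, \<Delta> \<turnstile> C\<close>, with \<open>k\<close> and \<open>m\<close>
  the lengths of \<open>\<Upsilon>\<close> and \<open>\<Gamma>\<close>: contracts each formula of \<open>!\<Gamma>\<close> with its copy in
  the same place of the second block.
\<close>

fun contract_dup :: "nat \<Rightarrow> nat \<Rightarrow> 'a deriv \<Rightarrow> 'a deriv" where
  "contract_dup k 0 p = p"
| "contract_dup k (Suc m) p = contract_dup (Suc k) m (Contr k (exch_left (Suc k) m p))"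

section \<open>Equivalence under cut-elimination\<close>

text \<open>
  \<open>p \<approx> q \<triangleright> \<Gamma> \<turnstile> C\<close>: the proofs \<open>p\<close> and \<open>q\<close> of the sequent
  \<open>\<Gamma> \<turnstile> C\<close> are equivalent. Permutations of two rules neither of which is a cut, such as
  \<open>TensL\<close> past \<open>TensR\<close>, are not listed when they follow by cutting against an axiom and
  moving that cut. Besides the identities for contraction and weakening, exchanges compose
  as permutations do, and they pass through promotion, which cuts do not give.
\<close>

inductive equiv_deriv :: "'a deriv \<Rightarrow> 'a deriv \<Rightarrow> 'a form list \<Rightarrow> 'a form \<Rightarrow> bool"
    ("_ \<approx> _ \<triangleright> _ \<turnstile> _" [51, 51, 50, 50] 50) where
\<comment> \<open>congruence\<close>
  equiv_refl: "p \<triangleright> \<Gamma> \<turnstile> C \<Longrightarrow> p \<approx> p \<triangleright> \<Gamma> \<turnstile> C"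
| equiv_sym: "p \<approx> q \<triangleright> \<Gamma> \<turnstile> C \<Longrightarrow> q \<approx> p \<triangleright> \<Gamma> \<turnstile> C"
| equiv_trans: "p \<approx> q \<triangleright> \<Gamma> \<turnstile> C \<Longrightarrow> q \<approx> r \<triangleright> \<Gamma> \<turnstile> C \<Longrightarrow> p \<approx> r \<triangleright> \<Gamma> \<turnstile> C"
| cong_Cut: "p \<approx> p' \<triangleright> \<Gamma> \<turnstile> A \<Longrightarrow> q \<approx> q' \<triangleright> \<Upsilon> @ A # \<Delta> \<turnstile> C \<Longrightarrow>
    Cut (length \<Upsilon>) p q \<approx> Cut (length \<Upsilon>) p' q' \<triangleright> \<Upsilon> @ \<Gamma> @ \<Delta> \<turnstile> C"
| cong_Unary: "left_rule L \<Theta> \<Theta>' \<Longrightarrow> p \<approx> p' \<triangleright> \<Upsilon> @ \<Theta> @ \<Delta> \<turnstile> C \<Longrightarrow>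
    L (length \<Upsilon>) p \<approx> L (length \<Upsilon>) p' \<triangleright> \<Upsilon> @ \<Theta>' @ \<Delta> \<turnstile> C"
| cong_TensR: "p \<approx> p' \<triangleright> \<Gamma> \<turnstile> A \<Longrightarrow> q \<approx> q' \<triangleright> \<Delta> \<turnstile> B \<Longrightarrow>
    TensR p q \<approx> TensR p' q' \<triangleright> \<Gamma> @ \<Delta> \<turnstile> A \<otimes> B"
| cong_WithR: "p \<approx> p' \<triangleright> \<Gamma> \<turnstile> A \<Longrightarrow> q \<approx> q' \<triangleright> \<Gamma> \<turnstile> B \<Longrightarrow>
    WithR p q \<approx> WithR p' q' \<triangleright> \<Gamma> \<turnstile> A \<^bold>& B"
| cong_LolliR: "p \<approx> p' \<triangleright> A # \<Gamma> \<turnstile> B \<Longrightarrow> LolliR p \<approx> LolliR p' \<triangleright> \<Gamma> \<turnstile> A \<multimap> B"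
| cong_LolliL: "p \<approx> p' \<triangleright> \<Gamma> \<turnstile> A \<Longrightarrow> q \<approx> q' \<triangleright> \<Upsilon> @ B # \<Delta> \<turnstile> C \<Longrightarrow>
    LolliL (length \<Upsilon>) p q \<approx> LolliL (length \<Upsilon>) p' q' \<triangleright> \<Upsilon> @ \<Gamma> @ (A \<multimap> B) # \<Delta> \<turnstile> C"
| cong_Prom: "p \<approx> p' \<triangleright> map Bang \<Gamma> \<turnstile> A \<Longrightarrow> Prom p \<approx> Prom p' \<triangleright> map Bang \<Gamma> \<turnstile> \<^bold>! A"
\<comment> \<open>\<open>\<eta>\<close>-expansion of axioms\<close>
| eta_Tensor: "Ax (A \<otimes> B) \<approx> TensL 0 (TensR (Ax A) (Ax B)) \<triangleright> [A \<otimes> B] \<turnstile> A \<otimes> B"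
| eta_With: "Ax (A \<^bold>& B) \<approx> WithR (WithL1 0 B (Ax A)) (WithL2 0 A (Ax B))
    \<triangleright> [A \<^bold>& B] \<turnstile> A \<^bold>& B"
| eta_Lolli: "Ax (A \<multimap> B) \<approx> LolliR (LolliL 0 (Ax A) (Ax B)) \<triangleright> [A \<multimap> B] \<turnstile> A \<multimap> B"
| eta_Bang: "Ax (\<^bold>! A) \<approx> Prom (Der 0 (Ax A)) \<triangleright> [\<^bold>! A] \<turnstile> \<^bold>! A"
\<comment> \<open>cut against an axiom\<close>
| cut_Ax_left: "q \<triangleright> \<Upsilon> @ A # \<Delta> \<turnstile> C \<Longrightarrow>
    Cut (length \<Upsilon>) (Ax A) q \<approx> q \<triangleright> \<Upsilon> @ A # \<Delta> \<turnstile> C"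
| cut_Ax_right: "p \<triangleright> \<Gamma> \<turnstile> A \<Longrightarrow> Cut 0 p (Ax A) \<approx> p \<triangleright> \<Gamma> \<turnstile> A"
\<comment> \<open>principal cuts\<close>
| cut_Tensor: "p \<triangleright> \<Gamma> \<turnstile> A \<Longrightarrow> q \<triangleright> \<Delta> \<turnstile> B \<Longrightarrow> r \<triangleright> \<Upsilon> @ A # B # \<Phi> \<turnstile> C \<Longrightarrow>
    Cut (length \<Upsilon>) (TensR p q) (TensL (length \<Upsilon>) r)
      \<approx> Cut (length \<Upsilon>) p (Cut (Suc (length \<Upsilon>)) q r) \<triangleright> \<Upsilon> @ \<Gamma> @ \<Delta> @ \<Phi> \<turnstile> C"
| cut_With1: "p \<triangleright> \<Gamma> \<turnstile> A \<Longrightarrow> q \<triangleright> \<Gamma> \<turnstile> B \<Longrightarrow> r \<triangleright> \<Upsilon> @ A # \<Delta> \<turnstile> C \<Longrightarrow>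
    Cut (length \<Upsilon>) (WithR p q) (WithL1 (length \<Upsilon>) B r) \<approx> Cut (length \<Upsilon>) p r
      \<triangleright> \<Upsilon> @ \<Gamma> @ \<Delta> \<turnstile> C"
| cut_With2: "p \<triangleright> \<Gamma> \<turnstile> A \<Longrightarrow> q \<triangleright> \<Gamma> \<turnstile> B \<Longrightarrow> r \<triangleright> \<Upsilon> @ B # \<Delta> \<turnstile> C \<Longrightarrow>
    Cut (length \<Upsilon>) (WithR p q) (WithL2 (length \<Upsilon>) A r) \<approx> Cut (length \<Upsilon>) q r
      \<triangleright> \<Upsilon> @ \<Gamma> @ \<Delta> \<turnstile> C"
| cut_Lolli: "p \<triangleright> A # \<Gamma> \<turnstile> B \<Longrightarrow> q \<triangleright> \<Delta> \<turnstile> A \<Longrightarrow> r \<triangleright> \<Upsilon> @ B # \<Phi> \<turnstile> C \<Longrightarrow>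
    Cut (length \<Upsilon> + length \<Delta>) (LolliR p) (LolliL (length \<Upsilon>) q r)
      \<approx> Cut (length \<Upsilon>) (Cut 0 q p) r \<triangleright> \<Upsilon> @ \<Delta> @ \<Gamma> @ \<Phi> \<turnstile> C"
| cut_Der: "p \<triangleright> map Bang \<Gamma> \<turnstile> A \<Longrightarrow> r \<triangleright> \<Upsilon> @ A # \<Delta> \<turnstile> C \<Longrightarrow>
    Cut (length \<Upsilon>) (Prom p) (Der (length \<Upsilon>) r) \<approx> Cut (length \<Upsilon>) p r
      \<triangleright> \<Upsilon> @ map Bang \<Gamma> @ \<Delta> \<turnstile> C"
| cut_Weak: "p \<triangleright> map Bang \<Gamma> \<turnstile> A \<Longrightarrow> r \<triangleright> \<Upsilon> @ \<Delta> \<turnstile> C \<Longrightarrow>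
    Cut (length \<Upsilon>) (Prom p) (Weak (length \<Upsilon>) A r) \<approx> weaken_all (length \<Upsilon>) \<Gamma> r
      \<triangleright> \<Upsilon> @ map Bang \<Gamma> @ \<Delta> \<turnstile> C"
| cut_Contr: "p \<triangleright> map Bang \<Gamma> \<turnstile> A \<Longrightarrow> r \<triangleright> \<Upsilon> @ \<^bold>! A # \<^bold>! A # \<Delta> \<turnstile> C \<Longrightarrow>
    Cut (length \<Upsilon>) (Prom p) (Contr (length \<Upsilon>) r)
      \<approx> contract_dup (length \<Upsilon>) (length \<Gamma>)
          (Cut (length \<Upsilon>) (Prom p) (Cut (Suc (length \<Upsilon>)) (Prom p) r))
      \<triangleright> \<Upsilon> @ map Bang \<Gamma> @ \<Delta> \<turnstile> C"
| cut_Prom: "p \<triangleright> map Bang \<Gamma> \<turnstile> A \<Longrightarrow> q \<triangleright> map Bang \<Upsilon> @ \<^bold>! A # map Bang \<Delta> \<turnstile> B \<Longrightarrow>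
    Cut (length \<Upsilon>) (Prom p) (Prom q) \<approx> Prom (Cut (length \<Upsilon>) (Prom p) q)
      \<triangleright> map Bang \<Upsilon> @ map Bang \<Gamma> @ map Bang \<Delta> \<turnstile> \<^bold>! B"
| cut_Exch1: "p \<triangleright> \<Gamma> \<turnstile> A \<Longrightarrow> q \<triangleright> \<Upsilon> @ A # B # \<Delta> \<turnstile> C \<Longrightarrow>
    Cut (Suc (length \<Upsilon>)) p (Exch (length \<Upsilon>) q)
      \<approx> exch_left (length \<Upsilon>) (length \<Gamma>) (Cut (length \<Upsilon>) p q)
      \<triangleright> \<Upsilon> @ B # \<Gamma> @ \<Delta> \<turnstile> C"
| cut_Exch2: "p \<triangleright> \<Gamma> \<turnstile> A \<Longrightarrow> q \<triangleright> \<Upsilon> @ B # A # \<Delta> \<turnstile> C \<Longrightarrow>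
    Cut (length \<Upsilon>) p (Exch (length \<Upsilon>) q)
      \<approx> exch_right (length \<Upsilon>) (length \<Gamma>) (Cut (Suc (length \<Upsilon>)) p q)
      \<triangleright> \<Upsilon> @ \<Gamma> @ B # \<Delta> \<turnstile> C"
\<comment> \<open>cut past cut\<close>
| cut_Cut_assoc: "p \<triangleright> \<Gamma> \<turnstile> A \<Longrightarrow> q \<triangleright> \<Upsilon>' @ A # \<Delta>' \<turnstile> B \<Longrightarrow> r \<triangleright> \<Upsilon> @ B # \<Delta> \<turnstile> C \<Longrightarrow>
    Cut (length \<Upsilon>) (Cut (length \<Upsilon>') p q) r
      \<approx> Cut (length \<Upsilon> + length \<Upsilon>') p (Cut (length \<Upsilon>) q r)
      \<triangleright> \<Upsilon> @ \<Upsilon>' @ \<Gamma> @ \<Delta>' @ \<Delta> \<turnstile> C"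
| cut_Cut_comm: "p \<triangleright> \<Gamma> \<turnstile> A \<Longrightarrow> q \<triangleright> \<Delta> \<turnstile> B \<Longrightarrow> r \<triangleright> \<Upsilon> @ A # \<Phi> @ B # \<Psi> \<turnstile> C \<Longrightarrow>
    Cut (length \<Upsilon>) p (Cut (length \<Upsilon> + 1 + length \<Phi>) q r)
      \<approx> Cut (length \<Upsilon> + length \<Gamma> + length \<Phi>) q (Cut (length \<Upsilon>) p r)
      \<triangleright> \<Upsilon> @ \<Gamma> @ \<Phi> @ \<Delta> @ \<Psi> \<turnstile> C"
\<comment> \<open>cut past the last rule of its left premise\<close>
| cut_Unary_left: "left_rule L \<Theta> \<Theta>' \<Longrightarrow> p \<triangleright> \<Upsilon>' @ \<Theta> @ \<Delta>' \<turnstile> A \<Longrightarrow> q \<triangleright> \<Upsilon> @ A # \<Delta> \<turnstile> C \<Longrightarrow>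
    Cut (length \<Upsilon>) (L (length \<Upsilon>') p) q \<approx> L (length \<Upsilon> + length \<Upsilon>') (Cut (length \<Upsilon>) p q)
      \<triangleright> \<Upsilon> @ \<Upsilon>' @ \<Theta>' @ \<Delta>' @ \<Delta> \<turnstile> C"
| cut_LolliL_left: "p \<triangleright> \<Gamma> \<turnstile> D \<Longrightarrow> q \<triangleright> \<Upsilon>' @ E # \<Delta>' \<turnstile> A \<Longrightarrow> r \<triangleright> \<Upsilon> @ A # \<Delta> \<turnstile> C \<Longrightarrow>
    Cut (length \<Upsilon>) (LolliL (length \<Upsilon>') p q) r
      \<approx> LolliL (length \<Upsilon> + length \<Upsilon>') p (Cut (length \<Upsilon>) q r)
      \<triangleright> \<Upsilon> @ \<Upsilon>' @ \<Gamma> @ (D \<multimap> E) # \<Delta>' @ \<Delta> \<turnstile> C"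
\<comment> \<open>cut past the last rule of its right premise, where the cut formula is not principal\<close>
| cut_Unary_right1: "left_rule L \<Theta> \<Theta>' \<Longrightarrow> p \<triangleright> \<Gamma> \<turnstile> A \<Longrightarrow> q \<triangleright> \<Upsilon> @ A # \<Phi> @ \<Theta> @ \<Psi> \<turnstile> C \<Longrightarrow>
    Cut (length \<Upsilon>) p (L (length \<Upsilon> + 1 + length \<Phi>) q)
      \<approx> L (length \<Upsilon> + length \<Gamma> + length \<Phi>) (Cut (length \<Upsilon>) p q)
      \<triangleright> \<Upsilon> @ \<Gamma> @ \<Phi> @ \<Theta>' @ \<Psi> \<turnstile> C"
| cut_Unary_right2: "left_rule L \<Theta> \<Theta>' \<Longrightarrow> p \<triangleright> \<Gamma> \<turnstile> A \<Longrightarrow> q \<triangleright> \<Upsilon> @ \<Theta> @ \<Phi> @ A # \<Psi> \<turnstile> C \<Longrightarrow>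
    Cut (length \<Upsilon> + length \<Theta>' + length \<Phi>) p (L (length \<Upsilon>) q)
      \<approx> L (length \<Upsilon>) (Cut (length \<Upsilon> + length \<Theta> + length \<Phi>) p q)
      \<triangleright> \<Upsilon> @ \<Theta>' @ \<Phi> @ \<Gamma> @ \<Psi> \<turnstile> C"
| cut_TensR1: "p \<triangleright> \<Gamma> \<turnstile> A \<Longrightarrow> q \<triangleright> \<Upsilon> @ A # \<Delta> \<turnstile> B \<Longrightarrow> r \<triangleright> \<Phi> \<turnstile> C \<Longrightarrow>
    Cut (length \<Upsilon>) p (TensR q r) \<approx> TensR (Cut (length \<Upsilon>) p q) r
      \<triangleright> \<Upsilon> @ \<Gamma> @ \<Delta> @ \<Phi> \<turnstile> B \<otimes> C"
| cut_TensR2: "p \<triangleright> \<Gamma> \<turnstile> A \<Longrightarrow> q \<triangleright> \<Phi> \<turnstile> B \<Longrightarrow> r \<triangleright> \<Upsilon> @ A # \<Delta> \<turnstile> C \<Longrightarrow>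
    Cut (length \<Phi> + length \<Upsilon>) p (TensR q r) \<approx> TensR q (Cut (length \<Upsilon>) p r)
      \<triangleright> \<Phi> @ \<Upsilon> @ \<Gamma> @ \<Delta> \<turnstile> B \<otimes> C"
| cut_WithR: "p \<triangleright> \<Gamma> \<turnstile> A \<Longrightarrow> q \<triangleright> \<Upsilon> @ A # \<Delta> \<turnstile> B \<Longrightarrow> r \<triangleright> \<Upsilon> @ A # \<Delta> \<turnstile> C \<Longrightarrow>
    Cut (length \<Upsilon>) p (WithR q r) \<approx> WithR (Cut (length \<Upsilon>) p q) (Cut (length \<Upsilon>) p r)
      \<triangleright> \<Upsilon> @ \<Gamma> @ \<Delta> \<turnstile> B \<^bold>& C"
| cut_LolliR: "p \<triangleright> \<Gamma> \<turnstile> A \<Longrightarrow> q \<triangleright> B # \<Upsilon> @ A # \<Delta> \<turnstile> C \<Longrightarrow>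
    Cut (length \<Upsilon>) p (LolliR q) \<approx> LolliR (Cut (Suc (length \<Upsilon>)) p q)
      \<triangleright> \<Upsilon> @ \<Gamma> @ \<Delta> \<turnstile> B \<multimap> C"
| cut_LolliL1: "p \<triangleright> \<Gamma> \<turnstile> A \<Longrightarrow> q \<triangleright> \<Upsilon>' @ A # \<Delta>' \<turnstile> B \<Longrightarrow> r \<triangleright> \<Upsilon> @ D # \<Delta> \<turnstile> C \<Longrightarrow>
    Cut (length \<Upsilon> + length \<Upsilon>') p (LolliL (length \<Upsilon>) q r)
      \<approx> LolliL (length \<Upsilon>) (Cut (length \<Upsilon>') p q) r
      \<triangleright> \<Upsilon> @ \<Upsilon>' @ \<Gamma> @ \<Delta>' @ (B \<multimap> D) # \<Delta> \<turnstile> C"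
| cut_LolliL2: "p \<triangleright> \<Gamma> \<turnstile> A \<Longrightarrow> q \<triangleright> \<Delta> \<turnstile> B \<Longrightarrow> r \<triangleright> \<Upsilon> @ A # \<Phi> @ D # \<Psi> \<turnstile> C \<Longrightarrow>
    Cut (length \<Upsilon>) p (LolliL (length \<Upsilon> + 1 + length \<Phi>) q r)
      \<approx> LolliL (length \<Upsilon> + length \<Gamma> + length \<Phi>) q (Cut (length \<Upsilon>) p r)
      \<triangleright> \<Upsilon> @ \<Gamma> @ \<Phi> @ \<Delta> @ (B \<multimap> D) # \<Psi> \<turnstile> C"
| cut_LolliL3: "p \<triangleright> \<Gamma> \<turnstile> A \<Longrightarrow> q \<triangleright> \<Delta> \<turnstile> B \<Longrightarrow> r \<triangleright> \<Upsilon> @ D # \<Phi> @ A # \<Psi> \<turnstile> C \<Longrightarrow>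
    Cut (length \<Upsilon> + length \<Delta> + 1 + length \<Phi>) p (LolliL (length \<Upsilon>) q r)
      \<approx> LolliL (length \<Upsilon>) q (Cut (length \<Upsilon> + 1 + length \<Phi>) p r)
      \<triangleright> \<Upsilon> @ \<Delta> @ (B \<multimap> D) # \<Phi> @ \<Gamma> @ \<Psi> \<turnstile> C"
\<comment> \<open>identities for the structural rules\<close>
| contr_assoc: "p \<triangleright> \<Upsilon> @ \<^bold>! A # \<^bold>! A # \<^bold>! A # \<Delta> \<turnstile> C \<Longrightarrow>
    Contr (length \<Upsilon>) (Contr (length \<Upsilon>) p) \<approx> Contr (length \<Upsilon>) (Contr (Suc (length \<Upsilon>)) p)
      \<triangleright> \<Upsilon> @ \<^bold>! A # \<Delta> \<turnstile> C"
| contr_comm: "p \<triangleright> \<Upsilon> @ \<^bold>! A # \<^bold>! A # \<Delta> \<turnstile> C \<Longrightarrow>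
    Contr (length \<Upsilon>) (Exch (length \<Upsilon>) p) \<approx> Contr (length \<Upsilon>) p \<triangleright> \<Upsilon> @ \<^bold>! A # \<Delta> \<turnstile> C"
| contr_weak1: "p \<triangleright> \<Upsilon> @ \<^bold>! A # \<Delta> \<turnstile> C \<Longrightarrow>
    Contr (length \<Upsilon>) (Weak (length \<Upsilon>) A p) \<approx> p \<triangleright> \<Upsilon> @ \<^bold>! A # \<Delta> \<turnstile> C"
| contr_weak2: "p \<triangleright> \<Upsilon> @ \<^bold>! A # \<Delta> \<turnstile> C \<Longrightarrow>
    Contr (length \<Upsilon>) (Weak (Suc (length \<Upsilon>)) A p) \<approx> p \<triangleright> \<Upsilon> @ \<^bold>! A # \<Delta> \<turnstile> C"
| exch_exch: "p \<triangleright> \<Upsilon> @ A # B # \<Delta> \<turnstile> C \<Longrightarrow>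
    Exch (length \<Upsilon>) (Exch (length \<Upsilon>) p) \<approx> p \<triangleright> \<Upsilon> @ A # B # \<Delta> \<turnstile> C"
| exch_braid: "p \<triangleright> \<Upsilon> @ A # B # D # \<Delta> \<turnstile> C \<Longrightarrow>
    Exch (length \<Upsilon>) (Exch (Suc (length \<Upsilon>)) (Exch (length \<Upsilon>) p))
      \<approx> Exch (Suc (length \<Upsilon>)) (Exch (length \<Upsilon>) (Exch (Suc (length \<Upsilon>)) p))
      \<triangleright> \<Upsilon> @ D # B # A # \<Delta> \<turnstile> C"
| exch_comm: "p \<triangleright> \<Upsilon> @ A # B # \<Phi> @ D # E # \<Delta> \<turnstile> C \<Longrightarrow>
    Exch (length \<Upsilon>) (Exch (length \<Upsilon> + 2 + length \<Phi>) p)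
      \<approx> Exch (length \<Upsilon> + 2 + length \<Phi>) (Exch (length \<Upsilon>) p)
      \<triangleright> \<Upsilon> @ B # A # \<Phi> @ E # D # \<Delta> \<turnstile> C"
| exch_Prom: "p \<triangleright> map Bang \<Upsilon> @ \<^bold>! A # \<^bold>! B # map Bang \<Delta> \<turnstile> C \<Longrightarrow>
    Prom (Exch (length \<Upsilon>) p) \<approx> Exch (length \<Upsilon>) (Prom p)
      \<triangleright> map Bang \<Upsilon> @ \<^bold>! B # \<^bold>! A # map Bang \<Delta> \<turnstile> \<^bold>! C"

section \<open>Plain proofs\<close>

text \<open>Iterated tensors associate to the left. The empty list, for which there is no unit, is not used.\<close>

definition big_tensor :: "'a form list \<Rightarrow> 'a form" where
  "big_tensor As = foldl Tensor (hd As) (tl As)"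

definition big_TensR :: "'a deriv list \<Rightarrow> 'a deriv" where
  "big_TensR ps = foldl TensR (hd ps) (tl ps)"

text \<open>From \<open>A\<^sub>1, \<dots>, A\<^sub>r \<turnstile> C\<close> to \<open>A\<^sub>1 \<otimes> \<dots> \<otimes> A\<^sub>r \<turnstile> C\<close>, for \<open>r \<ge> 1\<close>.\<close>

definition big_TensL :: "nat \<Rightarrow> 'a deriv \<Rightarrow> 'a deriv" where
  "big_TensL r p = (TensL 0 ^^ (r - 1)) p"

definition derelict_all :: "nat \<Rightarrow> 'a deriv \<Rightarrow> 'a deriv" where
  "derelict_all m p = fold Der [0..<m] p"

text \<open>Replaces \<open>m\<close> copies of \<open>!A\<close> starting at position \<open>k\<close> by a single one.\<close>

fun merge_copies :: "nat \<Rightarrow> 'a form \<Rightarrow> nat \<Rightarrow> 'a deriv \<Rightarrow> 'a deriv" where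
  "merge_copies k A 0 p = Weak k A p"
| "merge_copies k A (Suc 0) p = p"
| "merge_copies k A (Suc (Suc m)) p = merge_copies k A (Suc m) (Contr k p)"

fun merge_all :: "nat \<Rightarrow> (nat \<times> 'a form) list \<Rightarrow> 'a deriv \<Rightarrow> 'a deriv" where
  "merge_all k [] p = p"
| "merge_all k ((m, A) # xs) p = merge_all (Suc k) xs (merge_copies k A m p)"

definition plain :: "'a form list \<Rightarrow> 'a form \<Rightarrow> 'a deriv \<Rightarrow> bool" where
  "plain As B \<psi> \<longleftrightarrow> (\<exists>ns \<pi>. length ns = length As \<and>
     \<pi> \<triangleright> concat (map2 replicate ns As) \<turnstile> B \<and>
     \<psi> \<approx> merge_all 0 (zip ns As) (derelict_all (sum_list ns) \<pi>) \<triangleright> map Bang As \<turnstile> B)"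

text \<open>
  The tensor of the \<open>t\<close> promotions has as hypotheses \<open>t\<close> consecutive blocks
  \<open>!A\<^sub>1, \<dots>, !A\<^sub>r\<close>, contracted into one, two blocks at a time.
\<close>

definition component_wise_plain :: "'a form list \<Rightarrow> 'a form list \<Rightarrow> 'a deriv \<Rightarrow> bool" where
  "component_wise_plain As Bs \<psi> \<longleftrightarrow> Bs \<noteq> [] \<and> (\<exists>\<psi>s. list_all2 (plain As) Bs \<psi>s \<and>
     \<psi> \<approx> (contract_dup 0 (length As) ^^ (length Bs - 1)) (big_TensR (map Prom \<psi>s))
       \<triangleright> map Bang As \<turnstile> big_tensor (map Bang Bs))"

text \<open>The same notion for proofs of \<open>!A\<^sub>1 \<otimes> \<dots> \<otimes> !A\<^sub>r \<turnstile> !B\<^sub>1 \<otimes> \<dots> \<otimes> !B\<^sub>t\<close>.\<close>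

definition component_wise_plain_tensor :: "'a form list \<Rightarrow> 'a form list \<Rightarrow> 'a deriv \<Rightarrow> bool" where
  "component_wise_plain_tensor As Bs \<psi> \<longleftrightarrow> As \<noteq> [] \<and> (\<exists>\<phi>. component_wise_plain As Bs \<phi> \<and>
     \<psi> \<approx> big_TensL (length As) \<phi>
       \<triangleright> [big_tensor (map Bang As)] \<turnstile> big_tensor (map Bang Bs))"

section \<open>Booleans and Turing machine configurations\<close>

text \<open>\<open>A \<^bold>& \<dots> \<^bold>& A\<close> with \<open>m \<ge> 1\<close> factors, associated to the left; the value at \<open>m = 0\<close> is not used.\<close>

fun with_power :: "'a form \<Rightarrow> nat \<Rightarrow> 'a form" where
  "with_power A 0 = A"
| "with_power A (Suc 0) = A"
| "with_power A (Suc (Suc m)) = with_power A (Suc m) \<^bold>& A"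

fun proj :: "'a form \<Rightarrow> nat \<Rightarrow> nat \<Rightarrow> 'a deriv" where
  "proj A 0 i = Ax A"
| "proj A (Suc 0) i = Ax A"
| "proj A (Suc (Suc m)) i =
     (if i = Suc m then WithL2 0 (with_power A (Suc m)) (Ax A)
      else WithL1 0 A (proj A (Suc m) i))"

definition boolean :: "nat \<Rightarrow> 'a form \<Rightarrow> 'a form" where
  "boolean m A = with_power A m \<multimap> A"

definition bool_val :: "nat \<Rightarrow> 'a form \<Rightarrow> nat \<Rightarrow> 'a deriv" where
  "bool_val m A i = LolliR (proj A m i)"

datatype direction = Left | Right

fun move :: "nat \<Rightarrow> direction \<Rightarrow> nat \<Rightarrow> nat" where
  "move h Left i = nat ((int i - 1) mod int h)"
| "move h Right i = nat ((int i + 1) mod int h)"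

text \<open>The tape squares, the state and the head position, in this order, without the exponentials.\<close>

definition config_types :: "nat \<Rightarrow> nat \<Rightarrow> nat \<Rightarrow> 'a form \<Rightarrow> 'a form list" where
  "config_types s n h A = replicate h (boolean s A) @ [boolean n A, boolean h A]"

definition config_formula :: "nat \<Rightarrow> nat \<Rightarrow> nat \<Rightarrow> 'a form \<Rightarrow> 'a form" where
  "config_formula s n h A = big_tensor (map Bang (config_types s n h A))"

definition config_proof ::
    "nat \<Rightarrow> nat \<Rightarrow> nat \<Rightarrow> 'a form \<Rightarrow> (nat \<Rightarrow> nat) \<Rightarrow> nat \<Rightarrow> nat \<Rightarrow> 'a deriv" where
  "config_proof s n h A \<sigma> q i = big_TensR (map Prom
     (map (\<lambda>j. bool_val s A (\<sigma> j)) [0..<h] @ [bool_val n A q, bool_val h A i]))"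

end

theory Submission
  imports Defs
begin

text \<open>
  Every function of booleans has a linear proof \<open>B\<^sub>1, \<dots>, B\<^sub>r \<turnstile> B\<close>: a decision tree applies each input
  boolean to the tuple of the subtrees for its possible values, and since the premises of
  \<open>WithR\<close> share their context, the remaining inputs are not duplicated. Derelicting its hypotheses
  makes it plain with all \<open>n\<^sub>i = 1\<close>, and the transition step is the tensor of such proofs, one for
  each component of the configuration. All values are closed proofs, so cutting against them
  moves through exchanges and contractions without leaving any structural rules behind.
\<close>

section \<open>Cuts against closed proofs\<close>

text \<open>A boolean over \<open>A\<close> can only be eliminated into \<open>A\<close>, while each
  wanted output is again of the form \<open>A^m \<multimap> A\<close>. A tree therefore concludes
  \<open>A\<close> and keeps the output tuple \<open>A^m\<close> as an extra hypothesis; its leaves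
  project from this tuple, and \<open>LolliR\<close> is applied once, below the finished tree.
  Taking every multiplicity to be one means that no input may be dropped, so every branch inspects
  every input, even those on which its component does not depend. The leaves number the product of
  all arities, but only existence matters.

  Feeding a configuration is expressed by \<open>fold (Cut 0)\<close>, successive cuts of closed
  proofs at the head of the context. Such a fold is pushed inwards through the layers of the
  construction: left tensor rules, contractions of blocks, the tensor of the components, promotion,
  dereliction, \<open>LolliR\<close> and the tree, with one equation per layer. The difficulty is
  the order of the cuts: several conversions produce or require them in another order than the fold,
  and \<open>cut_Cut_comm\<close> has to reconcile the two.\<close>

lemma closed_Cut: "p \<triangleright> [] \<turnstile> A \<Longrightarrow> q \<triangleright> \<Upsilon> @ A # \<Delta> \<turnstile> C \<Longrightarrow> Cut (length \<Upsilon>) p q \<triangleright> \<Upsilon> @ \<Delta> \<turnstile> C"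
  using proves.Cut[of p "[]"] by simp

lemma closed_Cut0: "p \<triangleright> [] \<turnstile> A \<Longrightarrow> q \<triangleright> A # \<Delta> \<turnstile> C \<Longrightarrow> Cut 0 p q \<triangleright> \<Delta> \<turnstile> C"
  using closed_Cut[of p A q "[]"] by simp

lemma closed_Cut_cong: "p \<triangleright> [] \<turnstile> A \<Longrightarrow> q \<approx> q' \<triangleright> \<Upsilon> @ A # \<Delta> \<turnstile> C \<Longrightarrow>
    Cut (length \<Upsilon>) p q \<approx> Cut (length \<Upsilon>) p q' \<triangleright> \<Upsilon> @ \<Delta> \<turnstile> C"
  using cong_Cut[OF equiv_refl, of p "[]"] by simp

lemma closed_Cut0_cong: "p \<triangleright> [] \<turnstile> A \<Longrightarrow> q \<approx> q' \<triangleright> A # \<Delta> \<turnstile> C \<Longrightarrow> Cut 0 p q \<approx> Cut 0 p q' \<triangleright> \<Delta> \<turnstile> C"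
  using closed_Cut_cong[of p A q q' "[]"] by simp

abbreviation closed :: "'a deriv list \<Rightarrow> 'a form list \<Rightarrow> bool" where
  "closed ps As \<equiv> list_all2 (\<lambda>p A. p \<triangleright> [] \<turnstile> A) ps As"

lemma closed_Prom: "closed ps As \<Longrightarrow> closed (map Prom ps) (map Bang As)"
  using Prom[of _ "[]"] by (auto simp: list_all2_map1 list_all2_map2 elim!: list_all2_mono)

text \<open>A closed proof contributes no hypotheses, so after each cut the next formula of
  \<open>As\<close> slides into the same position. Hence one fixed position serves the whole list,
  in the order of the context.\<close>

lemma fold_Cut: "closed ps As \<Longrightarrow> q \<triangleright> \<Upsilon> @ As @ \<Delta> \<turnstile> C \<Longrightarrow> fold (Cut (length \<Upsilon>)) ps q \<triangleright> \<Upsilon> @ \<Delta> \<turnstile> C"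
  by (induction arbitrary: q rule: list_all2_induct) (auto intro: closed_Cut)

lemma fold_Cut0: "closed ps As \<Longrightarrow> q \<triangleright> As @ \<Delta> \<turnstile> C \<Longrightarrow> fold (Cut 0) ps q \<triangleright> \<Delta> \<turnstile> C"
  using fold_Cut[of ps As q "[]"] by simp

lemma fold_Cut_cong: "closed ps As \<Longrightarrow> q \<approx> q' \<triangleright> \<Upsilon> @ As @ \<Delta> \<turnstile> C \<Longrightarrow>
    fold (Cut (length \<Upsilon>)) ps q \<approx> fold (Cut (length \<Upsilon>)) ps q' \<triangleright> \<Upsilon> @ \<Delta> \<turnstile> C"
  by (induction arbitrary: q q' rule: list_all2_induct) (auto intro: closed_Cut_cong)

lemma fold_Cut0_cong: "closed ps As \<Longrightarrow> q \<approx> q' \<triangleright> As @ \<Delta> \<turnstile> C \<Longrightarrow>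
    fold (Cut 0) ps q \<approx> fold (Cut 0) ps q' \<triangleright> \<Delta> \<turnstile> C"
  using fold_Cut_cong[of ps As q q' "[]"] by simp

lemma closed_Cut_comm:
  assumes "p \<triangleright> [] \<turnstile> A" "q \<triangleright> [] \<turnstile> B" "r \<triangleright> \<Upsilon> @ A # \<Phi> @ B # \<Psi> \<turnstile> C"
  shows "Cut (length \<Upsilon>) p (Cut (Suc (length \<Upsilon> + length \<Phi>)) q r)
    \<approx> Cut (length \<Upsilon> + length \<Phi>) q (Cut (length \<Upsilon>) p r) \<triangleright> \<Upsilon> @ \<Phi> @ \<Psi> \<turnstile> C"
  using cut_Cut_comm[OF assms] by simp

text \<open>Each cut for the block \<open>As\<close> moves \<open>B\<close> one place to the left,
  until it stands at \<open>length \<Upsilon>\<close>. This reconciles the fold, which reaches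
  \<open>B\<close> last, with conversions in which the cut at \<open>B\<close> comes first.\<close>

lemma fold_Cut_comm:
  assumes "closed ps As" "p \<triangleright> [] \<turnstile> B" "q \<triangleright> \<Upsilon> @ As @ B # \<Delta> \<turnstile> C"
  shows "fold (Cut (length \<Upsilon>)) ps (Cut (length \<Upsilon> + length ps) p q)
    \<approx> Cut (length \<Upsilon>) p (fold (Cut (length \<Upsilon>)) ps q) \<triangleright> \<Upsilon> @ \<Delta> \<turnstile> C"
  using assms
proof (induction arbitrary: q rule: list_all2_induct)
  case Nil
  then show ?case by (auto intro: equiv_refl closed_Cut)
next
  case (Cons a as A As)
  have len: "length as = length As" using Cons(2) by (rule list_all2_lengthD)
  have "Cut (length \<Upsilon>) a (Cut (length \<Upsilon> + length (a # as)) p q)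
      \<approx> Cut (length \<Upsilon> + length as) p (Cut (length \<Upsilon>) a q) \<triangleright> \<Upsilon> @ As @ \<Delta> \<turnstile> C"
    using closed_Cut_comm[of a A p B q \<Upsilon> As \<Delta> C] Cons by (simp add: len)
  then have "fold (Cut (length \<Upsilon>)) as (Cut (length \<Upsilon>) a (Cut (length \<Upsilon> + length (a # as)) p q))
      \<approx> fold (Cut (length \<Upsilon>)) as (Cut (length \<Upsilon> + length as) p (Cut (length \<Upsilon>) a q)) \<triangleright> \<Upsilon> @ \<Delta> \<turnstile> C"
    by (rule fold_Cut_cong[OF Cons(2)])
  moreover have "Cut (length \<Upsilon>) a q \<triangleright> \<Upsilon> @ As @ B # \<Delta> \<turnstile> C"
    using Cons by (auto intro: closed_Cut)
  ultimately show ?case using Cons by (auto intro: equiv_trans)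
qed

text \<open>Removing the formula at the head lowers by one the position at which a rule further
  right acts. The shift lemmas for exchange, contraction and dereliction rest on this case.\<close>

lemma closed_Cut_shift:
  assumes "left_rule L \<Theta> \<Theta>'" "p \<triangleright> [] \<turnstile> A" "q \<triangleright> A # \<Upsilon> @ \<Theta> @ \<Delta> \<turnstile> C"
  shows "Cut 0 p (L (Suc (length \<Upsilon>)) q) \<approx> L (length \<Upsilon>) (Cut 0 p q) \<triangleright> \<Upsilon> @ \<Theta>' @ \<Delta> \<turnstile> C"
  using cut_Unary_right1[of L \<Theta> \<Theta>' p "[]" A q "[]" \<Upsilon> \<Delta> C] assms by simp

section \<open>Tensors\<close>

lemma big_tensor_snoc: "As \<noteq> [] \<Longrightarrow> big_tensor (As @ [A]) = big_tensor As \<otimes> A"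
  by (simp add: big_tensor_def)

lemma big_TensR_snoc: "ps \<noteq> [] \<Longrightarrow> big_TensR (ps @ [p]) = TensR (big_TensR ps) p"
  by (simp add: big_TensR_def)

lemma big_TensR:
  assumes "list_all2 (\<lambda>q B. q \<triangleright> \<Gamma> \<turnstile> B) qs Bs" "qs \<noteq> []"
  shows "big_TensR qs \<triangleright> concat (replicate (length qs) \<Gamma>) \<turnstile> big_tensor Bs"
  using assms
proof (induction qs arbitrary: Bs rule: rev_induct)
  case (snoc q qs)
  then obtain B Bs' where Bs: "Bs = Bs' @ [B]" and q: "q \<triangleright> \<Gamma> \<turnstile> B"
    and qs: "list_all2 (\<lambda>q B. q \<triangleright> \<Gamma> \<turnstile> B) qs Bs'"
    by (auto simp: list_all2_append1 list_all2_Cons1)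
  show ?case
  proof (cases "qs = []")
    case True
    then show ?thesis using q qs Bs by (simp add: big_TensR_def big_tensor_def)
  next
    case False
    moreover from False have "Bs' \<noteq> []" using qs by auto
    moreover have "concat (replicate (length (qs @ [q])) \<Gamma>) = concat (replicate (length qs) \<Gamma>) @ \<Gamma>"
      by (simp flip: replicate_append_same)
    ultimately show ?thesis
      using TensR[OF snoc.IH[OF qs False] q] Bs by (simp add: big_TensR_snoc big_tensor_snoc)
  qed
qed simp

lemma big_TensR_closed: "closed ps As \<Longrightarrow> ps \<noteq> [] \<Longrightarrow> big_TensR ps \<triangleright> [] \<turnstile> big_tensor As"
  using big_TensR[of "[]" ps As] by simp

lemma big_TensR_cong:
  assumes "list_all2 (\<lambda>(q, q') B. q \<approx> q' \<triangleright> [] \<turnstile> B) (zip qs qs') Bs" "length qs = length qs'" "qs \<noteq> []"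
  shows "big_TensR qs \<approx> big_TensR qs' \<triangleright> [] \<turnstile> big_tensor Bs"
  using assms(2,1,3)
proof (induction qs qs' arbitrary: Bs rule: rev_induct2)
  case (4 q qs q' qs')
  then have len: "length qs = length qs'" by simp
  from 4 obtain B Bs' where Bs: "Bs = Bs' @ [B]" and q: "q \<approx> q' \<triangleright> [] \<turnstile> B"
    and qs: "list_all2 (\<lambda>(q, q') B. q \<approx> q' \<triangleright> [] \<turnstile> B) (zip qs qs') Bs'"
    by (auto simp: list_all2_append1 list_all2_Cons1)
  show ?case
  proof (cases "qs = []")
    case True
    then show ?thesis using q qs Bs len by (simp add: big_TensR_def big_tensor_def)
  next
    case False
    moreover from False have "Bs' \<noteq> []" "qs' \<noteq> []" using qs len by auto
    ultimately show ?thesis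
      using cong_TensR[OF 4(1)[OF len qs False] q] Bs by (simp add: big_TensR_snoc big_tensor_snoc)
  qed
qed auto

lemma big_TensL_Suc: "r \<ge> 1 \<Longrightarrow> big_TensL (Suc r) q = TensL 0 (big_TensL r q)"
  by (cases r) (simp_all add: big_TensL_def)

lemma TensL0: "q \<triangleright> A # B # \<Delta> \<turnstile> C \<Longrightarrow> TensL 0 q \<triangleright> A \<otimes> B # \<Delta> \<turnstile> C"
  using Unary[OF left_rule.intros(2), of q "[]"] by simp

lemma big_TensL:
  assumes "q \<triangleright> As @ \<Delta> \<turnstile> C" "As \<noteq> []"
  shows "big_TensL (length As) q \<triangleright> big_tensor As # \<Delta> \<turnstile> C"
  using assms
proof (induction As arbitrary: \<Delta> rule: rev_induct)
  case (snoc A As)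
  show ?case
  proof (cases "As = []")
    case True
    then show ?thesis using snoc by (simp add: big_TensL_def big_tensor_def)
  next
    case False
    then show ?thesis using snoc
      by (simp add: big_TensL_Suc big_tensor_snoc TensL0 Suc_le_eq)
  qed
qed simp

text \<open>Tensors associate to the left, so the last factor is outermost and the induction peels
  the lists from the right, with \<open>\<Delta>\<close> collecting the peeled formulas.\<close>

lemma cut_big_Tensor:
  assumes "closed ps As" "q \<triangleright> As @ \<Delta> \<turnstile> C" "ps \<noteq> []"
  shows "Cut 0 (big_TensR ps) (big_TensL (length ps) q) \<approx> fold (Cut 0) ps q \<triangleright> \<Delta> \<turnstile> C"
  using assms
proof (induction ps arbitrary: As \<Delta> rule: rev_induct)
  case (snoc p ps)
  then obtain A As' where As: "As = As' @ [A]" and p: "p \<triangleright> [] \<turnstile> A" and ps: "closed ps As'"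
    by (auto simp: list_all2_append1 list_all2_Cons1)
  have q: "q \<triangleright> As' @ A # \<Delta> \<turnstile> C" using snoc As by simp
  show ?case
  proof (cases "ps = []")
    case True
    then show ?thesis using p ps q
      by (auto simp: big_TensL_def big_TensR_def intro: equiv_refl closed_Cut0)
  next
    case False
    define P where "P = big_TensR ps"
    define R where "R = big_TensL (length ps) q"
    have len: "length ps = length As'" and As': "As' \<noteq> []" using ps False by (auto dest: list_all2_lengthD)
    have P: "P \<triangleright> [] \<turnstile> big_tensor As'" using big_TensR_closed[OF ps False] by (simp add: P_def)
    have R: "R \<triangleright> big_tensor As' # A # \<Delta> \<turnstile> C" using big_TensL[OF q As'] by (simp add: R_def len)
    have "Cut 0 (TensR P p) (TensL 0 R) \<approx> Cut 0 P (Cut 1 p R) \<triangleright> \<Delta> \<turnstile> C"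
      using cut_Tensor[OF P p, of R "[]"] R by simp
    \<comment> \<open>The principal cut leaves the cut of \<open>p\<close> inside that of
      \<open>P\<close>. The induction hypothesis is about cutting \<open>P\<close> into
      \<open>R\<close> directly, so the two trade places.\<close>
    moreover have "Cut 0 P (Cut 1 p R) \<approx> Cut 0 p (Cut 0 P R) \<triangleright> \<Delta> \<turnstile> C"
      using closed_Cut_comm[OF P p, of R "[]" "[]"] R by simp
    moreover have "Cut 0 P R \<approx> fold (Cut 0) ps q \<triangleright> A # \<Delta> \<turnstile> C"
      unfolding P_def R_def by (rule snoc.IH[OF ps q False])
    then have "Cut 0 p (Cut 0 P R) \<approx> Cut 0 p (fold (Cut 0) ps q) \<triangleright> \<Delta> \<turnstile> C"
      by (rule closed_Cut0_cong[OF p])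
    ultimately show ?thesis using False
      by (auto simp: big_TensR_snoc big_TensL_Suc Suc_le_eq P_def R_def intro: equiv_trans)
  qed
qed simp

section \<open>Distributing cuts over the factors of a tensor of proofs\<close>

lemma fold_Cut_TensR1:
  assumes "closed ps As" "q \<triangleright> As @ \<Delta> \<turnstile> B" "r \<triangleright> \<Phi> \<turnstile> C"
  shows "fold (Cut 0) ps (TensR q r) \<approx> TensR (fold (Cut 0) ps q) r \<triangleright> \<Delta> @ \<Phi> \<turnstile> B \<otimes> C"
  using assms
proof (induction arbitrary: q rule: list_all2_induct)
  case Nil
  then show ?case by (auto intro: equiv_refl TensR)
next
  case (Cons p ps A As)
  have "Cut 0 p (TensR q r) \<approx> TensR (Cut 0 p q) r \<triangleright> As @ \<Delta> @ \<Phi> \<turnstile> B \<otimes> C"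
    using cut_TensR1[of p "[]" A q "[]" "As @ \<Delta>" B r \<Phi> C] Cons by simp
  from fold_Cut0_cong[OF Cons(2) this] show ?case
    using Cons by (auto intro: equiv_trans closed_Cut0)
qed

lemma fold_Cut_TensR2:
  assumes "closed ps As" "q \<triangleright> [] \<turnstile> B" "r \<triangleright> As @ \<Phi> \<turnstile> C"
  shows "fold (Cut 0) ps (TensR q r) \<approx> TensR q (fold (Cut 0) ps r) \<triangleright> \<Phi> \<turnstile> B \<otimes> C"
  using assms
proof (induction arbitrary: r rule: list_all2_induct)
  case Nil
  then show ?case using TensR[of q "[]"] by (auto intro: equiv_refl)
next
  case (Cons p ps A As)
  have "Cut 0 p (TensR q r) \<approx> TensR q (Cut 0 p r) \<triangleright> As @ \<Phi> \<turnstile> B \<otimes> C"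
    using cut_TensR2[of p "[]" A q "[]" B r "[]" "As @ \<Phi>" C] Cons by simp
  from fold_Cut0_cong[OF Cons(2) this] show ?case
    using Cons by (auto intro: equiv_trans closed_Cut0)
qed

lemma funpow_fold_Cut_cong:
  assumes "closed ps As" "q \<approx> q' \<triangleright> concat (replicate t As) @ \<Delta> \<turnstile> C"
  shows "(fold (Cut 0) ps ^^ t) q \<approx> (fold (Cut 0) ps ^^ t) q' \<triangleright> \<Delta> \<turnstile> C"
  using assms(2)
proof (induction t arbitrary: q q')
  case (Suc t)
  then show ?case using fold_Cut0_cong[OF assms(1)] by (simp add: funpow_swap1)
qed simp

lemma funpow_fold_Cut:
  assumes "closed ps As" "q \<triangleright> concat (replicate t As) @ \<Delta> \<turnstile> C"
  shows "(fold (Cut 0) ps ^^ t) q \<triangleright> \<Delta> \<turnstile> C"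
  using assms(2)
proof (induction t arbitrary: q)
  case (Suc t)
  then show ?case using fold_Cut0[OF assms(1)] by (simp add: funpow_swap1)
qed simp

lemma funpow_fold_Cut_TensR1:
  assumes "closed ps As" "q \<triangleright> concat (replicate t As) \<turnstile> B" "r \<triangleright> \<Phi> \<turnstile> C"
  shows "(fold (Cut 0) ps ^^ t) (TensR q r) \<approx> TensR ((fold (Cut 0) ps ^^ t) q) r \<triangleright> \<Phi> \<turnstile> B \<otimes> C"
  using assms(2)
proof (induction t arbitrary: q)
  case 0
  then show ?case using assms TensR[of q "[]"] by (auto intro: equiv_refl)
next
  case (Suc t)
  have "fold (Cut 0) ps (TensR q r) \<approx> TensR (fold (Cut 0) ps q) r
      \<triangleright> concat (replicate t As) @ \<Phi> \<turnstile> B \<otimes> C"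
    using fold_Cut_TensR1[OF assms(1) _ assms(3), of q "concat (replicate t As)"] Suc by simp
  from funpow_fold_Cut_cong[OF assms(1) this] Suc fold_Cut0[OF assms(1)] show ?case
    by (auto simp: funpow_swap1 intro: equiv_trans)
qed

text \<open>The context has one block \<open>As\<close> per factor, in the order of the factors, and
  each round of the fold uses up the leftmost block. So all rounds but the last enter the left part
  of the outermost tensor, which is closed by the time the last round reaches
  \<open>q\<close>.\<close>

lemma funpow_fold_Cut_big_TensR:
  assumes ps: "closed ps As" and "list_all2 (\<lambda>q B. q \<triangleright> As \<turnstile> B) qs Bs" "qs \<noteq> []"
  shows "(fold (Cut 0) ps ^^ length qs) (big_TensR qs) \<approx> big_TensR (map (fold (Cut 0) ps) qs)
    \<triangleright> [] \<turnstile> big_tensor Bs"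
  using assms(2,3)
proof (induction qs arbitrary: Bs rule: rev_induct)
  case (snoc q qs)
  then obtain B Bs' where Bs: "Bs = Bs' @ [B]" and q: "q \<triangleright> As \<turnstile> B"
    and qs: "list_all2 (\<lambda>q B. q \<triangleright> As \<turnstile> B) qs Bs'"
    by (auto simp: list_all2_append1 list_all2_Cons1)
  have q': "fold (Cut 0) ps q \<triangleright> [] \<turnstile> B" using fold_Cut0[OF ps, of q "[]"] q by simp
  show ?case
  proof (cases "qs = []")
    case True
    then show ?thesis using q' qs Bs by (auto simp: big_TensR_def big_tensor_def intro: equiv_refl)
  next
    case False
    let ?f = "fold (Cut 0) ps" and ?t = "length qs"
    have Q: "big_TensR qs \<triangleright> concat (replicate ?t As) \<turnstile> big_tensor Bs'" by (rule big_TensR[OF qs False])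
    have Q': "(?f ^^ ?t) (big_TensR qs) \<triangleright> [] \<turnstile> big_tensor Bs'"
      using funpow_fold_Cut[OF ps, of _ ?t "[]"] Q by simp
    have "(?f ^^ ?t) (TensR (big_TensR qs) q) \<approx> TensR ((?f ^^ ?t) (big_TensR qs)) q
        \<triangleright> As @ [] \<turnstile> big_tensor Bs' \<otimes> B"
      using funpow_fold_Cut_TensR1[OF ps Q q] by simp
    then have "?f ((?f ^^ ?t) (TensR (big_TensR qs) q)) \<approx> ?f (TensR ((?f ^^ ?t) (big_TensR qs)) q)
        \<triangleright> [] \<turnstile> big_tensor Bs' \<otimes> B"
      by (rule fold_Cut0_cong[OF ps])
    moreover have "?f (TensR ((?f ^^ ?t) (big_TensR qs)) q) \<approx> TensR ((?f ^^ ?t) (big_TensR qs)) (?f q)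
        \<triangleright> [] \<turnstile> big_tensor Bs' \<otimes> B"
      using fold_Cut_TensR2[OF ps Q', of q "[]"] q by simp
    moreover have "TensR ((?f ^^ ?t) (big_TensR qs)) (?f q) \<approx> TensR (big_TensR (map ?f qs)) (?f q)
        \<triangleright> [] @ [] \<turnstile> big_tensor Bs' \<otimes> B"
      by (rule cong_TensR[OF snoc.IH[OF qs False] equiv_refl[OF q']])
    moreover have "Bs' \<noteq> []" using qs False by auto
    ultimately show ?thesis using False Bs
      by (auto simp: big_TensR_snoc big_tensor_snoc intro: equiv_trans)
  qed
qed simp

section \<open>Exchange and contraction\<close>

lemma exch_left_0 [simp]: "exch_left k 0 p = p"
  by (simp add: exch_left_def)

lemma exch_left_Suc: "exch_left k (Suc m) p = Exch k (exch_left (Suc k) m p)"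
proof -
  have "[k..<k + Suc m] = k # [Suc k..<Suc k + m]" by (simp add: upt_conv_Cons del: upt_Suc)
  then show ?thesis by (simp add: exch_left_def del: upt_Suc)
qed

lemma exch_left_cong: "q \<approx> q' \<triangleright> \<Upsilon> @ As @ B # \<Delta> \<turnstile> C \<Longrightarrow>
    exch_left (length \<Upsilon>) (length As) q \<approx> exch_left (length \<Upsilon>) (length As) q' \<triangleright> \<Upsilon> @ B # As @ \<Delta> \<turnstile> C"
proof (induction As arbitrary: \<Upsilon>)
  case (Cons A As)
  have "exch_left (Suc (length \<Upsilon>)) (length As) q \<approx> exch_left (Suc (length \<Upsilon>)) (length As) q'
      \<triangleright> \<Upsilon> @ [A, B] @ As @ \<Delta> \<turnstile> C"
    using Cons.IH[of "\<Upsilon> @ [A]"] Cons.prems by simp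
  from cong_Unary[OF left_rule.intros(1) this] show ?case by (simp add: exch_left_Suc)
qed simp

lemma exch_left: "q \<triangleright> \<Upsilon> @ As @ B # \<Delta> \<turnstile> C \<Longrightarrow> exch_left (length \<Upsilon>) (length As) q \<triangleright> \<Upsilon> @ B # As @ \<Delta> \<turnstile> C"
proof (induction As arbitrary: \<Upsilon>)
  case (Cons A As)
  have "exch_left (Suc (length \<Upsilon>)) (length As) q \<triangleright> \<Upsilon> @ [A, B] @ As @ \<Delta> \<turnstile> C"
    using Cons.IH[of "\<Upsilon> @ [A]"] Cons.prems by simp
  from Unary[OF left_rule.intros(1) this] show ?case by (simp add: exch_left_Suc)
qed simp

lemma closed_Cut_exch_left_shift:
  assumes "p \<triangleright> [] \<turnstile> D" "q \<triangleright> D # \<Upsilon> @ As @ B # \<Delta> \<turnstile> C"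
  shows "Cut 0 p (exch_left (Suc (length \<Upsilon>)) (length As) q)
    \<approx> exch_left (length \<Upsilon>) (length As) (Cut 0 p q) \<triangleright> \<Upsilon> @ B # As @ \<Delta> \<turnstile> C"
  using assms
proof (induction As arbitrary: \<Upsilon>)
  case Nil
  then show ?case by (auto intro: equiv_refl closed_Cut0)
next
  case (Cons A As)
  let ?q = "exch_left (Suc (Suc (length \<Upsilon>))) (length As) q"
  have q: "?q \<triangleright> D # \<Upsilon> @ [A, B] @ As @ \<Delta> \<turnstile> C"
    using exch_left[of q "D # \<Upsilon> @ [A]" As B \<Delta> C] Cons.prems by simp
  have "Cut 0 p (Exch (Suc (length \<Upsilon>)) ?q) \<approx> Exch (length \<Upsilon>) (Cut 0 p ?q) \<triangleright> \<Upsilon> @ [B, A] @ As @ \<Delta> \<turnstile> C"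
    by (rule closed_Cut_shift[OF left_rule.intros(1) Cons.prems(1) q])
  moreover have "Cut 0 p ?q \<approx> exch_left (Suc (length \<Upsilon>)) (length As) (Cut 0 p q) \<triangleright> \<Upsilon> @ [A, B] @ As @ \<Delta> \<turnstile> C"
    using Cons.IH[of "\<Upsilon> @ [A]"] Cons.prems by simp
  from cong_Unary[OF left_rule.intros(1) this]
  have "Exch (length \<Upsilon>) (Cut 0 p ?q) \<approx> Exch (length \<Upsilon>) (exch_left (Suc (length \<Upsilon>)) (length As) (Cut 0 p q))
    \<triangleright> \<Upsilon> @ [B, A] @ As @ \<Delta> \<turnstile> C" .
  ultimately show ?case by (auto simp: exch_left_Suc intro: equiv_trans)
qed

text \<open>Every \<open>cut_Exch2\<close> strips one exchange and puts back an
  \<open>exch_right\<close> over the context of \<open>p\<close>, which is empty. So cutting the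
  moved formula amounts to cutting it where it stood before the move.\<close>

lemma closed_Cut_exch_left:
  assumes "p \<triangleright> [] \<turnstile> B" "q \<triangleright> \<Upsilon> @ As @ B # \<Delta> \<turnstile> C"
  shows "Cut (length \<Upsilon>) p (exch_left (length \<Upsilon>) (length As) q)
    \<approx> Cut (length \<Upsilon> + length As) p q \<triangleright> \<Upsilon> @ As @ \<Delta> \<turnstile> C"
  using assms
proof (induction As arbitrary: \<Upsilon>)
  case Nil
  then show ?case by (auto intro: equiv_refl closed_Cut)
next
  case (Cons A As)
  let ?q = "exch_left (Suc (length \<Upsilon>)) (length As) q"
  have q: "?q \<triangleright> \<Upsilon> @ A # B # As @ \<Delta> \<turnstile> C"
    using exch_left[of q "\<Upsilon> @ [A]" As B \<Delta> C] Cons.prems by simp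
  have "Cut (length \<Upsilon>) p (Exch (length \<Upsilon>) ?q) \<approx> Cut (Suc (length \<Upsilon>)) p ?q \<triangleright> \<Upsilon> @ A # As @ \<Delta> \<turnstile> C"
    using cut_Exch2[OF Cons.prems(1) q] by (simp add: exch_right_def)
  moreover have "Cut (Suc (length \<Upsilon>)) p ?q \<approx> Cut (Suc (length \<Upsilon> + length As)) p q \<triangleright> \<Upsilon> @ A # As @ \<Delta> \<turnstile> C"
    using Cons.IH[of "\<Upsilon> @ [A]"] Cons.prems by simp
  ultimately show ?case by (auto simp: exch_left_Suc intro: equiv_trans)
qed

section \<open>Contraction of two equal blocks of hypotheses\<close>

lemma contract_dup_cong: "q \<approx> q' \<triangleright> \<Upsilon> @ map Bang As @ map Bang As @ \<Delta> \<turnstile> C \<Longrightarrow>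
    contract_dup (length \<Upsilon>) (length As) q \<approx> contract_dup (length \<Upsilon>) (length As) q'
      \<triangleright> \<Upsilon> @ map Bang As @ \<Delta> \<turnstile> C"
proof (induction As arbitrary: \<Upsilon> q q')
  case (Cons A As)
  let ?e = "\<lambda>q. exch_left (Suc (length \<Upsilon>)) (length As) q"
  have "?e q \<approx> ?e q' \<triangleright> \<Upsilon> @ [\<^bold>! A, \<^bold>! A] @ map Bang As @ map Bang As @ \<Delta> \<turnstile> C"
    using exch_left_cong[of q q' "\<Upsilon> @ [\<^bold>! A]" "map Bang As"] Cons.prems by simp
  from cong_Unary[OF left_rule.intros(7) this] Cons.IH[of _ _ "\<Upsilon> @ [\<^bold>! A]"] show ?case by simp
qed simp

lemma contract_dup: "q \<triangleright> \<Upsilon> @ map Bang As @ map Bang As @ \<Delta> \<turnstile> C \<Longrightarrow>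
    contract_dup (length \<Upsilon>) (length As) q \<triangleright> \<Upsilon> @ map Bang As @ \<Delta> \<turnstile> C"
proof (induction As arbitrary: \<Upsilon> q)
  case (Cons A As)
  let ?e = "\<lambda>q. exch_left (Suc (length \<Upsilon>)) (length As) q"
  have "?e q \<triangleright> \<Upsilon> @ [\<^bold>! A, \<^bold>! A] @ map Bang As @ map Bang As @ \<Delta> \<turnstile> C"
    using exch_left[of q "\<Upsilon> @ [\<^bold>! A]" "map Bang As"] Cons.prems by simp
  from Unary[OF left_rule.intros(7) this] Cons.IH[of _ "\<Upsilon> @ [\<^bold>! A]"] show ?case by simp
qed simp

lemma closed_Cut_contract_dup_shift:
  assumes "p \<triangleright> [] \<turnstile> D" "q \<triangleright> D # \<Upsilon> @ map Bang As @ map Bang As @ \<Delta> \<turnstile> C"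
  shows "Cut 0 p (contract_dup (Suc (length \<Upsilon>)) (length As) q)
    \<approx> contract_dup (length \<Upsilon>) (length As) (Cut 0 p q) \<triangleright> \<Upsilon> @ map Bang As @ \<Delta> \<turnstile> C"
  using assms
proof (induction As arbitrary: \<Upsilon> q)
  case Nil
  then show ?case by (auto intro: equiv_refl closed_Cut0)
next
  case (Cons A As)
  let ?m = "length As" and ?k = "length \<Upsilon>" and ?\<Delta> = "map Bang As @ map Bang As @ \<Delta>"
  let ?e = "exch_left (Suc (Suc ?k)) ?m q"
  have e: "?e \<triangleright> D # \<Upsilon> @ [\<^bold>! A, \<^bold>! A] @ ?\<Delta> \<turnstile> C"
    using exch_left[of q "D # \<Upsilon> @ [\<^bold>! A]" "map Bang As"] Cons.prems by simp
  have c: "Contr (Suc ?k) ?e \<triangleright> D # \<Upsilon> @ [\<^bold>! A] @ ?\<Delta> \<turnstile> C"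
    using Unary[OF left_rule.intros(7), of ?e "D # \<Upsilon>"] e by simp
  have "Cut 0 p ?e \<approx> exch_left (Suc ?k) ?m (Cut 0 p q) \<triangleright> \<Upsilon> @ [\<^bold>! A, \<^bold>! A] @ ?\<Delta> \<turnstile> C"
    using closed_Cut_exch_left_shift[of p D q "\<Upsilon> @ [\<^bold>! A]" "map Bang As"] Cons.prems by simp
  then have "Contr ?k (Cut 0 p ?e) \<approx> Contr ?k (exch_left (Suc ?k) ?m (Cut 0 p q)) \<triangleright> \<Upsilon> @ [\<^bold>! A] @ ?\<Delta> \<turnstile> C"
    by (rule cong_Unary[OF left_rule.intros(7)])
  with closed_Cut_shift[OF left_rule.intros(7) Cons.prems(1) e]
  have "Cut 0 p (Contr (Suc ?k) ?e) \<approx> Contr ?k (exch_left (Suc ?k) ?m (Cut 0 p q)) \<triangleright> \<Upsilon> @ [\<^bold>! A] @ ?\<Delta> \<turnstile> C"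
    by (rule equiv_trans)
  from contract_dup_cong[of _ _ "\<Upsilon> @ [\<^bold>! A]" As] this
  have "contract_dup (Suc ?k) ?m (Cut 0 p (Contr (Suc ?k) ?e))
      \<approx> contract_dup (Suc ?k) ?m (Contr ?k (exch_left (Suc ?k) ?m (Cut 0 p q))) \<triangleright> \<Upsilon> @ [\<^bold>! A] @ map Bang As @ \<Delta> \<turnstile> C"
    by simp
  moreover have "Cut 0 p (contract_dup (Suc (Suc ?k)) ?m (Contr (Suc ?k) ?e))
      \<approx> contract_dup (Suc ?k) ?m (Cut 0 p (Contr (Suc ?k) ?e)) \<triangleright> \<Upsilon> @ [\<^bold>! A] @ map Bang As @ \<Delta> \<turnstile> C"
    using Cons.IH[of "Contr (Suc ?k) ?e" "\<Upsilon> @ [\<^bold>! A]"] Cons.prems c by simp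
  ultimately show ?case by (auto intro: equiv_trans)
qed

text \<open>Pairwise contraction interleaves the two blocks, while two rounds of the fold consume
  one block after the other. In the induction, both copies of the leading formula are cut at once,
  and the second of these cuts is then postponed until the rest of the first block is used
  up.\<close>

lemma fold_Cut_contract_dup:
  assumes "closed vs As" "q \<triangleright> map Bang As @ map Bang As @ \<Delta> \<turnstile> C"
  shows "fold (Cut 0) (map Prom vs) (contract_dup 0 (length As) q)
    \<approx> fold (Cut 0) (map Prom vs) (fold (Cut 0) (map Prom vs) q) \<triangleright> \<Delta> \<turnstile> C"
  using assms
proof (induction arbitrary: q rule: list_all2_induct)
  case Nil
  then show ?case by (auto intro: equiv_refl)
next
  case (Cons v vs A As)
  let ?p = "Prom v" and ?ps = "map Prom vs" and ?m = "length As" and ?As = "map Bang As"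
  have p: "?p \<triangleright> [] \<turnstile> \<^bold>! A" using Prom[of v "[]"] Cons by simp
  have ps: "closed ?ps ?As" using Cons(2) by (rule closed_Prom)
  have len: "length ?ps = ?m" using Cons(2) by (auto dest: list_all2_lengthD)
  let ?e = "exch_left 1 ?m q"
  have e: "?e \<triangleright> \<^bold>! A # \<^bold>! A # ?As @ ?As @ \<Delta> \<turnstile> C"
    using exch_left[of q "[\<^bold>! A]" ?As] Cons.prems by simp
  have c: "Contr 0 ?e \<triangleright> \<^bold>! A # ?As @ ?As @ \<Delta> \<turnstile> C"
    using Unary[OF left_rule.intros(7), of ?e "[]"] e by simp
  have q1: "Cut 0 ?p q \<triangleright> ?As @ \<^bold>! A # ?As @ \<Delta> \<turnstile> C"
    using closed_Cut0[OF p] Cons.prems by simp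
  have q2: "Cut ?m ?p (Cut 0 ?p q) \<triangleright> ?As @ ?As @ \<Delta> \<turnstile> C"
    using closed_Cut[OF p q1] by simp
  \<comment> \<open>\<open>cut_Contr\<close> ends with a \<open>contract_dup\<close> over the
    hypotheses of \<open>v\<close>; there are none, so just two cuts remain.\<close>
  have "Cut 0 ?p (Contr 0 ?e) \<approx> Cut 0 ?p (Cut 1 ?p ?e) \<triangleright> ?As @ ?As @ \<Delta> \<turnstile> C"
    using cut_Contr[of v "[]" A ?e "[]"] Cons e by simp
  \<comment> \<open>Once the cut of the first copy is innermost, it can pass under the exchanges
    that brought the second copy forward; the other cut then cancels them.\<close>
  moreover have "Cut 0 ?p (Cut 1 ?p ?e) \<approx> Cut 0 ?p (Cut 0 ?p ?e) \<triangleright> ?As @ ?As @ \<Delta> \<turnstile> C"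
    using closed_Cut_comm[OF p p, of ?e "[]" "[]"] e by simp
  moreover have "Cut 0 ?p ?e \<approx> exch_left 0 ?m (Cut 0 ?p q) \<triangleright> \<^bold>! A # ?As @ ?As @ \<Delta> \<turnstile> C"
    using closed_Cut_exch_left_shift[OF p, of q "[]" ?As] Cons.prems by simp
  then have "Cut 0 ?p (Cut 0 ?p ?e) \<approx> Cut 0 ?p (exch_left 0 ?m (Cut 0 ?p q)) \<triangleright> ?As @ ?As @ \<Delta> \<turnstile> C"
    by (rule closed_Cut0_cong[OF p])
  moreover have "Cut 0 ?p (exch_left 0 ?m (Cut 0 ?p q)) \<approx> Cut ?m ?p (Cut 0 ?p q) \<triangleright> ?As @ ?As @ \<Delta> \<turnstile> C"
    using closed_Cut_exch_left[OF p, of "Cut 0 ?p q" "[]" ?As] q1 by simp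
  ultimately have "Cut 0 ?p (Contr 0 ?e) \<approx> Cut ?m ?p (Cut 0 ?p q) \<triangleright> ?As @ ?As @ \<Delta> \<turnstile> C"
    by (blast intro: equiv_trans)
  then have "contract_dup 0 ?m (Cut 0 ?p (Contr 0 ?e)) \<approx> contract_dup 0 ?m (Cut ?m ?p (Cut 0 ?p q)) \<triangleright> ?As @ \<Delta> \<turnstile> C"
    using contract_dup_cong[of _ _ "[]"] by simp
  moreover have "Cut 0 ?p (contract_dup 1 ?m (Contr 0 ?e)) \<approx> contract_dup 0 ?m (Cut 0 ?p (Contr 0 ?e)) \<triangleright> ?As @ \<Delta> \<turnstile> C"
    using closed_Cut_contract_dup_shift[OF p, of "Contr 0 ?e" "[]"] c by simp
  ultimately have "Cut 0 ?p (contract_dup 1 ?m (Contr 0 ?e)) \<approx> contract_dup 0 ?m (Cut ?m ?p (Cut 0 ?p q)) \<triangleright> ?As @ \<Delta> \<turnstile> C"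
    by (blast intro: equiv_trans)
  from fold_Cut0_cong[OF ps this]
  have "fold (Cut 0) ?ps (Cut 0 ?p (contract_dup 1 ?m (Contr 0 ?e)))
      \<approx> fold (Cut 0) ?ps (contract_dup 0 ?m (Cut ?m ?p (Cut 0 ?p q))) \<triangleright> \<Delta> \<turnstile> C" .
  moreover have "fold (Cut 0) ?ps (contract_dup 0 ?m (Cut ?m ?p (Cut 0 ?p q)))
      \<approx> fold (Cut 0) ?ps (fold (Cut 0) ?ps (Cut ?m ?p (Cut 0 ?p q))) \<triangleright> \<Delta> \<turnstile> C"
    using Cons.IH q2 by simp
  \<comment> \<open>The second copy stands behind the remaining first block, so its cut has to wait
    for that block to be consumed.\<close>
  moreover have "fold (Cut 0) ?ps (Cut ?m ?p (Cut 0 ?p q)) \<approx> Cut 0 ?p (fold (Cut 0) ?ps (Cut 0 ?p q)) \<triangleright> ?As @ \<Delta> \<turnstile> C"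
    using fold_Cut_comm[OF ps p, of "Cut 0 ?p q" "[]"] q1 len by simp
  from fold_Cut0_cong[OF ps this]
  have "fold (Cut 0) ?ps (fold (Cut 0) ?ps (Cut ?m ?p (Cut 0 ?p q)))
      \<approx> fold (Cut 0) ?ps (Cut 0 ?p (fold (Cut 0) ?ps (Cut 0 ?p q))) \<triangleright> \<Delta> \<turnstile> C" .
  ultimately show ?case by (auto intro: equiv_trans)
qed

text \<open>\<open>t\<close> contractions join \<open>t + 1\<close> blocks. The innermost one merges
  the two leading blocks, so the induction hypothesis applies to the proof after it, and the first
  of the resulting rounds splits into two.\<close>

lemma fold_Cut_funpow_contract_dup:
  assumes vs: "closed vs As" and "q \<triangleright> concat (replicate (Suc t) (map Bang As)) @ \<Delta> \<turnstile> C"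
  shows "fold (Cut 0) (map Prom vs) ((contract_dup 0 (length As) ^^ t) q)
    \<approx> (fold (Cut 0) (map Prom vs) ^^ Suc t) q \<triangleright> \<Delta> \<turnstile> C"
  using assms(2)
proof (induction t arbitrary: q)
  case 0
  then show ?case using fold_Cut0[OF closed_Prom[OF vs], of q \<Delta>] by (auto intro: equiv_refl)
next
  case (Suc t)
  let ?f = "fold (Cut 0) (map Prom vs)"
  let ?\<Gamma> = "concat (replicate t (map Bang As)) @ \<Delta>"
  have q: "q \<triangleright> map Bang As @ map Bang As @ ?\<Gamma> \<turnstile> C" using Suc.prems by simp
  have "contract_dup 0 (length As) q \<triangleright> map Bang As @ ?\<Gamma> \<turnstile> C"
    using contract_dup[of q "[]"] q by simp
  then have "?f ((contract_dup 0 (length As) ^^ t) (contract_dup 0 (length As) q))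
      \<approx> (?f ^^ t) (?f (contract_dup 0 (length As) q)) \<triangleright> \<Delta> \<turnstile> C"
    using Suc.IH[of "contract_dup 0 (length As) q"] by (simp add: funpow_swap1)
  moreover have "?f (contract_dup 0 (length As) q) \<approx> ?f (?f q) \<triangleright> ?\<Gamma> \<turnstile> C"
    using fold_Cut_contract_dup[OF vs q] by simp
  from funpow_fold_Cut_cong[OF closed_Prom[OF vs] this]
  have "(?f ^^ t) (?f (contract_dup 0 (length As) q)) \<approx> (?f ^^ t) (?f (?f q)) \<triangleright> \<Delta> \<turnstile> C" .
  ultimately show ?case by (auto simp: funpow_swap1 intro: equiv_trans)
qed

section \<open>Promotion and dereliction\<close>

text \<open>\<open>cut_Prom\<close> asks for a promotion on the left and a context of the form
  \<open>map Bang\<close>. Both persist along the fold, since cutting \<open>Prom v\<close> into the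
  premise merely deletes one formula.\<close>

lemma fold_Cut_Prom:
  assumes "closed vs As" "q \<triangleright> map Bang As \<turnstile> B"
  shows "fold (Cut 0) (map Prom vs) (Prom q) \<approx> Prom (fold (Cut 0) (map Prom vs) q) \<triangleright> [] \<turnstile> \<^bold>! B"
  using assms
proof (induction arbitrary: q rule: list_all2_induct)
  case Nil
  then show ?case using Prom[of q "[]"] by (auto intro: equiv_refl)
next
  case (Cons v vs A As)
  have p: "Prom v \<triangleright> [] \<turnstile> \<^bold>! A" using Prom[of v "[]"] Cons by simp
  have "Cut 0 (Prom v) (Prom q) \<approx> Prom (Cut 0 (Prom v) q) \<triangleright> map Bang As @ [] \<turnstile> \<^bold>! B"
    using cut_Prom[of v "[]" A q "[]"] Cons by simp
  from fold_Cut0_cong[OF closed_Prom[OF Cons(2)] this]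
  have "fold (Cut 0) (map Prom vs) (Cut 0 (Prom v) (Prom q))
    \<approx> fold (Cut 0) (map Prom vs) (Prom (Cut 0 (Prom v) q)) \<triangleright> [] \<turnstile> \<^bold>! B" .
  moreover have "Cut 0 (Prom v) q \<triangleright> map Bang As \<turnstile> B"
    using closed_Cut0[OF p] Cons.prems by simp
  ultimately show ?case using Cons.IH by (auto intro: equiv_trans)
qed

text \<open>A variable starting position is forced by induction on the context: hypotheses already
  derelicted remain on the left.\<close>

definition derelict_from :: "nat \<Rightarrow> nat \<Rightarrow> 'a deriv \<Rightarrow> 'a deriv" where
  "derelict_from k m p = fold Der [k..<k + m] p"

lemma derelict_from_0 [simp]: "derelict_from k 0 p = p"
  by (simp add: derelict_from_def)

lemma derelict_from_Suc [simp]: "derelict_from k (Suc m) p = derelict_from (Suc k) m (Der k p)"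
proof -
  have "[k..<k + Suc m] = k # [Suc k..<Suc k + m]" by (simp add: upt_conv_Cons del: upt_Suc)
  then show ?thesis by (simp add: derelict_from_def del: upt_Suc)
qed

lemma derelict_all_eq: "derelict_all m p = derelict_from 0 m p"
  by (simp add: derelict_all_def derelict_from_def)

lemma derelict_from: "q \<triangleright> \<Upsilon> @ As \<turnstile> C \<Longrightarrow>
    derelict_from (length \<Upsilon>) (length As) q \<triangleright> \<Upsilon> @ map Bang As \<turnstile> C"
proof (induction As arbitrary: \<Upsilon> q)
  case (Cons A As)
  have "Der (length \<Upsilon>) q \<triangleright> (\<Upsilon> @ [\<^bold>! A]) @ As \<turnstile> C"
    using Unary[OF left_rule.intros(5), of q \<Upsilon> A As C] Cons.prems by simp
  from Cons.IH[OF this] show ?case by (simp)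
qed simp

lemma derelict_from_cong: "q \<approx> q' \<triangleright> \<Upsilon> @ As \<turnstile> C \<Longrightarrow>
    derelict_from (length \<Upsilon>) (length As) q \<approx> derelict_from (length \<Upsilon>) (length As) q'
      \<triangleright> \<Upsilon> @ map Bang As \<turnstile> C"
proof (induction As arbitrary: \<Upsilon> q q')
  case (Cons A As)
  have "Der (length \<Upsilon>) q \<approx> Der (length \<Upsilon>) q' \<triangleright> (\<Upsilon> @ [\<^bold>! A]) @ As \<turnstile> C"
    using cong_Unary[OF left_rule.intros(5), of q q' \<Upsilon> A As C] Cons.prems by simp
  from Cons.IH[OF this] show ?case by (simp)
qed simp

lemma closed_Cut_derelict_from_shift:
  assumes "p \<triangleright> [] \<turnstile> D" "q \<triangleright> D # \<Upsilon> @ As \<turnstile> C"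
  shows "Cut 0 p (derelict_from (Suc (length \<Upsilon>)) (length As) q)
    \<approx> derelict_from (length \<Upsilon>) (length As) (Cut 0 p q) \<triangleright> \<Upsilon> @ map Bang As \<turnstile> C"
  using assms
proof (induction As arbitrary: \<Upsilon> q)
  case Nil
  then show ?case by (auto intro: equiv_refl closed_Cut0)
next
  case (Cons A As)
  let ?k = "length \<Upsilon>" and ?m = "length As"
  have d: "Der (Suc ?k) q \<triangleright> D # (\<Upsilon> @ [\<^bold>! A]) @ As \<turnstile> C"
    using Unary[OF left_rule.intros(5), of q "D # \<Upsilon>" A As C] Cons.prems by simp
  have "Cut 0 p (Der (Suc ?k) q) \<approx> Der ?k (Cut 0 p q) \<triangleright> (\<Upsilon> @ [\<^bold>! A]) @ As \<turnstile> C"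
    using closed_Cut_shift[OF left_rule.intros(5) Cons.prems(1), of q \<Upsilon> A As C] Cons.prems by simp
  from derelict_from_cong[OF this] Cons.IH[OF Cons.prems(1) d]
  have "Cut 0 p (derelict_from (Suc (Suc ?k)) ?m (Der (Suc ?k) q))
      \<approx> derelict_from (Suc ?k) ?m (Der ?k (Cut 0 p q)) \<triangleright> \<Upsilon> @ \<^bold>! A # map Bang As \<turnstile> C"
    by (auto intro: equiv_trans)
  then show ?case by (simp)
qed

lemma derelict_all: "q \<triangleright> As \<turnstile> C \<Longrightarrow> derelict_all (length As) q \<triangleright> map Bang As \<turnstile> C"
  using derelict_from[of q "[]" As C] by (simp add: derelict_all_eq)

text \<open>Each promoted value meets the dereliction of its own hypothesis, and
  \<open>cut_Der\<close> removes both rules. The dereliction of the leading hypothesis is the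
  innermost one, so the cut first passes the others by the shift lemma.\<close>

lemma fold_Cut_derelict_all:
  assumes "closed vs As" "q \<triangleright> As \<turnstile> C"
  shows "fold (Cut 0) (map Prom vs) (derelict_all (length As) q) \<approx> fold (Cut 0) vs q \<triangleright> [] \<turnstile> C"
  using assms
proof (induction arbitrary: q rule: list_all2_induct)
  case Nil
  then show ?case by (auto simp: derelict_all_eq intro: equiv_refl)
next
  case (Cons v vs A As)
  let ?m = "length As"
  have v: "Prom v \<triangleright> [] \<turnstile> \<^bold>! A" using Prom[of v "[]"] Cons by simp
  have d: "Der 0 q \<triangleright> \<^bold>! A # As \<turnstile> C"
    using Unary[OF left_rule.intros(5), of q "[]" A As C] Cons.prems by simp
  have "Cut 0 (Prom v) (Der 0 q) \<approx> Cut 0 v q \<triangleright> As \<turnstile> C"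
    using cut_Der[of v "[]" A q "[]"] Cons by simp
  then have "derelict_all ?m (Cut 0 (Prom v) (Der 0 q)) \<approx> derelict_all ?m (Cut 0 v q) \<triangleright> map Bang As \<turnstile> C"
    using derelict_from_cong[of _ _ "[]"] by (simp add: derelict_all_eq)
  moreover have "derelict_all (length (A # As)) q = derelict_from 1 ?m (Der 0 q)"
    by (simp add: derelict_all_eq)
  then have "Cut 0 (Prom v) (derelict_all (length (A # As)) q)
      \<approx> derelict_all ?m (Cut 0 (Prom v) (Der 0 q)) \<triangleright> map Bang As \<turnstile> C"
    using closed_Cut_derelict_from_shift[OF v, of "Der 0 q" "[]"] d by (simp add: derelict_all_eq)
  ultimately have "Cut 0 (Prom v) (derelict_all (length (A # As)) q) \<approx> derelict_all ?m (Cut 0 v q)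
      \<triangleright> map Bang As @ [] \<turnstile> C"
    by (auto intro: equiv_trans)
  from fold_Cut0_cong[OF closed_Prom[OF Cons(2)] this]
  have "fold (Cut 0) (map Prom (v # vs)) (derelict_all (length (A # As)) q)
      \<approx> fold (Cut 0) (map Prom vs) (derelict_all ?m (Cut 0 v q)) \<triangleright> [] \<turnstile> C"
    by simp
  moreover have "Cut 0 v q \<triangleright> As \<turnstile> C" using closed_Cut0[OF Cons(1) Cons.prems[simplified]] .
  ultimately show ?case using Cons.IH by (auto intro: equiv_trans)
qed

section \<open>From linear proofs to component-wise plain proofs\<close>

lemma plain_derelict_all:
  assumes "\<pi> \<triangleright> As \<turnstile> B"
  shows "plain As B (derelict_all (length As) \<pi>)"
proof -
  have 1: "concat (map2 replicate (replicate (length As) (Suc 0)) As) = As"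
    by (induction As) simp_all
  have 2: "merge_all k (zip (replicate (length As) (Suc 0)) As) p = p" for k and p :: "'a deriv"
    by (induction As arbitrary: k) simp_all
  show ?thesis unfolding plain_def
    using assms 1 2
    by (intro exI[of _ "replicate (length As) (Suc 0)"] exI[of _ \<pi>])
      (simp add: sum_list_replicate derelict_all equiv_refl)
qed

text \<open>This is the interface between exponentials and booleans: it suffices to know what each
  linear component computes on closed arguments without promotion.\<close>

lemma component_wise_plain_tensor_linear:
  assumes \<pi>s: "list_all2 (\<lambda>\<pi> B. \<pi> \<triangleright> As \<turnstile> B) \<pi>s Bs" and "As \<noteq> []" "Bs \<noteq> []"
  obtains \<psi> where "\<psi> \<triangleright> [big_tensor (map Bang As)] \<turnstile> big_tensor (map Bang Bs)"
    "component_wise_plain_tensor As Bs \<psi>"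
    "\<And>vs ws. closed vs As \<Longrightarrow>
      list_all2 (\<lambda>(\<pi>, w) B. fold (Cut 0) vs \<pi> \<approx> w \<triangleright> [] \<turnstile> B) (zip \<pi>s ws) Bs \<Longrightarrow> length ws = length \<pi>s \<Longrightarrow>
      Cut 0 (big_TensR (map Prom vs)) \<psi> \<approx> big_TensR (map Prom ws) \<triangleright> [] \<turnstile> big_tensor (map Bang Bs)"
proof
  let ?\<psi>s = "map (derelict_all (length As)) \<pi>s" and ?As = "map Bang As" and ?Bs = "map Bang Bs"
  let ?\<Phi> = "big_TensR (map Prom ?\<psi>s)"
  let ?\<phi> = "(contract_dup 0 (length As) ^^ (length Bs - 1)) ?\<Phi>"
  let ?\<psi> = "big_TensL (length As) ?\<phi>"
  have len: "length \<pi>s = length Bs" using \<pi>s by (rule list_all2_lengthD)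
  then have "\<pi>s \<noteq> []" using assms by auto
  \<comment> \<open>Joining the blocks takes one contraction fewer than there are blocks;
    \<open>Bs \<noteq> []\<close> makes the truncated subtraction exact.\<close>
  have t: "Suc (length Bs - 1) = length Bs" using assms by simp
  have \<psi>s: "list_all2 (\<lambda>q B. q \<triangleright> ?As \<turnstile> B) ?\<psi>s Bs"
    using \<pi>s by (auto simp: list_all2_conv_all_nth derelict_all)
  then have Proms: "list_all2 (\<lambda>q B. q \<triangleright> ?As \<turnstile> B) (map Prom ?\<psi>s) ?Bs"
    by (auto simp: list_all2_conv_all_nth intro: Prom)
  then have \<Phi>: "?\<Phi> \<triangleright> concat (replicate (length Bs) ?As) \<turnstile> big_tensor ?Bs"
    using big_TensR[OF Proms] \<open>\<pi>s \<noteq> []\<close> len by simp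
  have "(contract_dup 0 (length As) ^^ t) q \<triangleright> ?As \<turnstile> C"
    if "q \<triangleright> concat (replicate (Suc t) ?As) \<turnstile> C" for t q and C :: "'a form"
    using that
  proof (induction t arbitrary: q)
    case (Suc t)
    then show ?case
      using contract_dup[of q "[]" As "concat (replicate t ?As)" C] by (simp add: funpow_swap1)
  qed simp
  from this[of ?\<Phi> "length Bs - 1"] \<Phi> t have \<phi>: "?\<phi> \<triangleright> ?As \<turnstile> big_tensor ?Bs" by metis
  show \<psi>: "?\<psi> \<triangleright> [big_tensor ?As] \<turnstile> big_tensor ?Bs"
    using big_TensL[of ?\<phi> ?As "[]"] \<phi> \<open>As \<noteq> []\<close> by simp
  have "list_all2 (plain As) Bs ?\<psi>s"
    using \<pi>s by (auto simp: list_all2_conv_all_nth plain_derelict_all)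
  then have "component_wise_plain As Bs ?\<phi>"
    unfolding component_wise_plain_def using equiv_refl[OF \<phi>] \<open>Bs \<noteq> []\<close> by blast
  then show "component_wise_plain_tensor As Bs ?\<psi>"
    unfolding component_wise_plain_tensor_def using equiv_refl[OF \<psi>] \<open>As \<noteq> []\<close> by blast
  fix vs ws
  assume vs: "closed vs As" and ws: "length ws = length \<pi>s"
    and eq: "list_all2 (\<lambda>(\<pi>, w) B. fold (Cut 0) vs \<pi> \<approx> w \<triangleright> [] \<turnstile> B) (zip \<pi>s ws) Bs"
  let ?ps = "map Prom vs"
  have ps: "closed ?ps ?As" using vs by (rule closed_Prom)
  have "length ?ps = length As" "?ps \<noteq> []" using list_all2_lengthD[OF vs] \<open>As \<noteq> []\<close> by auto
  then have "Cut 0 (big_TensR ?ps) ?\<psi> \<approx> fold (Cut 0) ?ps ?\<phi> \<triangleright> [] \<turnstile> big_tensor ?Bs"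
    using cut_big_Tensor[OF ps, of ?\<phi> "[]"] \<phi> by simp
  \<comment> \<open>Every output component receives its own copy of the input, hence
    \<open>length Bs\<close> rounds of the fold.\<close>
  moreover have "fold (Cut 0) ?ps ?\<phi> \<approx> (fold (Cut 0) ?ps ^^ length Bs) ?\<Phi> \<triangleright> [] \<turnstile> big_tensor ?Bs"
    using fold_Cut_funpow_contract_dup[OF vs, of ?\<Phi> "length Bs - 1" "[]"] \<Phi>
    by (simp only: t append_Nil2)
  moreover have "(fold (Cut 0) ?ps ^^ length Bs) ?\<Phi> \<approx> big_TensR (map (fold (Cut 0) ?ps) (map Prom ?\<psi>s))
      \<triangleright> [] \<turnstile> big_tensor ?Bs"
    using funpow_fold_Cut_big_TensR[OF ps Proms] \<open>\<pi>s \<noteq> []\<close> len by simp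
  moreover have "fold (Cut 0) ?ps (Prom (derelict_all (length As) (\<pi>s ! j))) \<approx> Prom (ws ! j)
      \<triangleright> [] \<turnstile> \<^bold>! (Bs ! j)" if j: "j < length Bs" for j
  proof -
    have \<pi>: "\<pi>s ! j \<triangleright> As \<turnstile> Bs ! j" using \<pi>s j by (simp add: list_all2_conv_all_nth)
    have "fold (Cut 0) vs (\<pi>s ! j) \<approx> ws ! j \<triangleright> [] \<turnstile> Bs ! j"
      using eq j len ws by (auto simp: list_all2_conv_all_nth)
    \<comment> \<open>The empty context is written \<open>map Bang []\<close> so that
      \<open>cong_Prom\<close> matches.\<close>
    with fold_Cut_derelict_all[OF vs \<pi>]
    have "fold (Cut 0) ?ps (derelict_all (length As) (\<pi>s ! j)) \<approx> ws ! j \<triangleright> map Bang [] \<turnstile> Bs ! j"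
      by (auto intro: equiv_trans)
    from cong_Prom[OF this] fold_Cut_Prom[OF vs derelict_all[OF \<pi>]] show ?thesis
      by (auto intro: equiv_trans)
  qed
  then have "big_TensR (map (fold (Cut 0) ?ps) (map Prom ?\<psi>s)) \<approx> big_TensR (map Prom ws)
      \<triangleright> [] \<turnstile> big_tensor ?Bs"
    using len ws \<open>\<pi>s \<noteq> []\<close> by (intro big_TensR_cong) (auto simp: list_all2_conv_all_nth)
  ultimately show "Cut 0 (big_TensR ?ps) ?\<psi> \<approx> big_TensR (map Prom ws) \<triangleright> [] \<turnstile> big_tensor ?Bs"
    by (blast intro: equiv_trans)
qed

section \<open>Decision trees\<close>

text \<open>Iterates \<open>WithR\<close> in the shape of \<open>with_power\<close>, including the
  default at 0, so that the typing is uniform in \<open>k\<close>.\<close>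

fun with_tuple :: "nat \<Rightarrow> (nat \<Rightarrow> 'a deriv) \<Rightarrow> 'a deriv" where
  "with_tuple 0 g = g 0"
| "with_tuple (Suc 0) g = g 0"
| "with_tuple (Suc (Suc k)) g = WithR (with_tuple (Suc k) g) (g (Suc k))"

lemma with_tuple: "(\<And>i. g i \<triangleright> \<Gamma> \<turnstile> A) \<Longrightarrow> with_tuple k g \<triangleright> \<Gamma> \<turnstile> with_power A k"
  by (induction k g rule: with_tuple.induct) (auto intro: WithR)

lemma proj: "proj A k i \<triangleright> [with_power A k] \<turnstile> A"
proof (induction A k i rule: proj.induct)
  case (3 A m i)
  then show ?case
    using Unary[OF left_rule.intros(3), of "proj A (Suc m) i" "[]" _ "[]"]
      Unary[OF left_rule.intros(4), of "Ax A" "[]" A "[]" A] Ax[of A] by auto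
qed (auto intro: Ax)

text \<open>The projection takes the tuple apart from the right: each principal cut either picks the
  last component or discards it.\<close>

lemma cut_with_tuple_proj:
  assumes g: "\<And>i. g i \<triangleright> \<Gamma> \<turnstile> A" and "i < k"
  shows "Cut 0 (with_tuple k g) (proj A k i) \<approx> g i \<triangleright> \<Gamma> \<turnstile> A"
  using assms
proof (induction k g rule: with_tuple.induct)
  case (2 g)
  then show ?case using cut_Ax_right[of "g 0"] by simp
next
  case (3 k g)
  note g = "3.prems"(1)
  show ?case
  proof (cases "i = Suc k")
    case True
    then show ?thesis
      using cut_With2[OF with_tuple[of g, OF g] g[of "Suc k"], where \<Upsilon> = "[]" and \<Delta> = "[]" and r = "Ax A"] cut_Ax_right[OF g]
      by (auto intro: equiv_trans proves.Ax)
  next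
    case False
    then show ?thesis
      using cut_With1[OF with_tuple[of g, OF g] g[of "Suc k"], where \<Upsilon> = "[]" and \<Delta> = "[]" and r = "proj A (Suc k) i"] 3 proj[of A "Suc k" i]
      by (auto intro: equiv_trans)
  qed
qed simp

lemma bool_val: "bool_val k A i \<triangleright> [] \<turnstile> boolean k A"
  unfolding bool_val_def boolean_def by (intro LolliR proj)

text \<open>
  The hypothesis inspected first stands last in the context, where \<open>LolliL\<close> puts it without
  any exchange.
\<close>

primrec decision :: "'a form \<Rightarrow> nat \<Rightarrow> nat list \<Rightarrow> (nat list \<Rightarrow> nat) \<Rightarrow> 'a deriv" where
  "decision A m [] f = proj A m (f [])"
| "decision A m (k # ks) f = LolliL 0 (with_tuple k (\<lambda>x. decision A m ks (\<lambda>xs. f (x # xs)))) (Ax A)"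

text \<open>The whole remaining context, the output tuple \<open>with_power A m\<close> included,
  goes to the argument of the inspected boolean; the other premise of \<open>LolliL\<close> is just
  an axiom.\<close>

lemma decision: "decision A m ks f \<triangleright> with_power A m # map (\<lambda>k. boolean k A) (rev ks) \<turnstile> A"
proof (induction ks arbitrary: f)
  case Nil
  then show ?case by (simp add: proj)
next
  case (Cons k ks)
  show ?case
    using LolliL[OF with_tuple[OF Cons], where \<Upsilon> = "[]" and \<Delta> = "[]", simplified, OF Ax] by (simp add: boolean_def)
qed

text \<open>Position 0 holds the output tuple, so values are cut at position 1. The fold meets the
  boolean at the root of the tree last; performing its cut first selects the subtree for
  \<open>x\<close>, in which the induction continues with \<open>f\<close> specialised.\<close>

lemma fold_Cut_decision:
  assumes "list_all2 (<) xs ks"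
  shows "fold (Cut 1) (map2 (\<lambda>k. bool_val k A) (rev ks) (rev xs)) (decision A m ks f)
    \<approx> proj A m (f xs) \<triangleright> [with_power A m] \<turnstile> A"
  using assms
proof (induction arbitrary: f rule: list_all2_induct)
  case Nil
  then show ?case by (simp add: proj equiv_refl)
next
  case (Cons x xs k ks)
  let ?vs = "map2 (\<lambda>k. bool_val k A) (rev ks) (rev xs)" and ?v = "bool_val k A x"
  let ?As = "map (\<lambda>k. boolean k A) (rev ks)"
  let ?g = "\<lambda>x. decision A m ks (\<lambda>xs. f (x # xs))" and ?\<Gamma> = "with_power A m # ?As"
  let ?t = "with_tuple k ?g"
  have len: "length xs = length ks" using Cons(2) by (rule list_all2_lengthD)
  have vs: "closed ?vs ?As" by (simp add: list_all2_conv_all_nth len bool_val)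
  have t: "?t \<triangleright> ?\<Gamma> \<turnstile> with_power A k" by (intro with_tuple decision)
  have tp: "Cut 0 ?t (proj A k x) \<triangleright> ?\<Gamma> \<turnstile> A"
    using proves.Cut[OF t, of "proj A k x" "[]" "[]"] proj[of A k x] by simp
  \<comment> \<open>\<open>bool_val\<close> is \<open>LolliR\<close> of a projection, so the
    principal cut feeds the tuple of subtrees to that projection.\<close>
  have "Cut (Suc (length ?vs)) ?v (decision A m (k # ks) f) \<approx> Cut 0 (Cut 0 ?t (proj A k x)) (Ax A) \<triangleright> ?\<Gamma> \<turnstile> A"
    using cut_Lolli[OF proj t, where \<Upsilon> = "[]" and \<Phi> = "[]" and r = "Ax A" and C = A] Ax[of A]
    by (simp add: bool_val_def len)
  moreover have "Cut 0 (Cut 0 ?t (proj A k x)) (Ax A) \<approx> Cut 0 ?t (proj A k x) \<triangleright> ?\<Gamma> \<turnstile> A"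
    by (rule cut_Ax_right[OF tp])
  moreover have "Cut 0 ?t (proj A k x) \<approx> ?g x \<triangleright> ?\<Gamma> \<turnstile> A"
    using cut_with_tuple_proj[OF decision Cons(1)] .
  ultimately have "Cut (Suc (length ?vs)) ?v (decision A m (k # ks) f) \<approx> ?g x \<triangleright> ?\<Gamma> \<turnstile> A"
    by (blast intro: equiv_trans)
  then have "fold (Cut 1) ?vs (Cut (Suc (length ?vs)) ?v (decision A m (k # ks) f))
      \<approx> fold (Cut 1) ?vs (?g x) \<triangleright> [with_power A m] \<turnstile> A"
    using fold_Cut_cong[OF vs, of _ _ "[with_power A m]" "[]"] by simp
  moreover have "fold (Cut 1) ?vs (Cut (Suc (length ?vs)) ?v (decision A m (k # ks) f))
      \<approx> Cut 1 ?v (fold (Cut 1) ?vs (decision A m (k # ks) f)) \<triangleright> [with_power A m] \<turnstile> A"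
    using fold_Cut_comm[OF vs bool_val, where q = "decision A m (k # ks) f" and \<Upsilon> = "[with_power A m]" and \<Delta> = "[]"]
      decision[of A m "k # ks" f] by simp
  ultimately show ?case using Cons.IH[of "\<lambda>xs. f (x # xs)"] len
    by (auto intro: equiv_trans equiv_sym)
qed

section \<open>Functions of several booleans\<close>

lemma fold_Cut_LolliR:
  assumes "closed vs As" "q \<triangleright> B # As \<turnstile> C"
  shows "fold (Cut 0) vs (LolliR q) \<approx> LolliR (fold (Cut 1) vs q) \<triangleright> [] \<turnstile> B \<multimap> C"
  using assms
proof (induction arbitrary: q rule: list_all2_induct)
  case Nil
  then show ?case by (auto intro: equiv_refl LolliR)
next
  case (Cons v vs A As)
  \<comment> \<open>Above \<open>LolliR\<close> the hypothesis \<open>B\<close> stands in front,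
    which moves the cut from position 0 to 1.\<close>
  have "Cut 0 v (LolliR q) \<approx> LolliR (Cut 1 v q) \<triangleright> As @ [] \<turnstile> B \<multimap> C"
    using cut_LolliR[of v "[]" A q B "[]" As C] Cons by simp
  from fold_Cut0_cong[OF Cons(2) this]
  have "fold (Cut 0) (v # vs) (LolliR q) \<approx> fold (Cut 0) vs (LolliR (Cut 1 v q)) \<triangleright> [] \<turnstile> B \<multimap> C" by simp
  moreover have "Cut 1 v q \<triangleright> B # As \<turnstile> C" using closed_Cut[of v A q "[B]"] Cons by simp
  ultimately show ?case using Cons.IH by (auto intro: equiv_trans)
qed

text \<open>\<open>decision\<close> has its hypotheses in reverse order of inspection, so
  \<open>ks\<close> is reversed and \<open>f\<close> has to read the answers backwards.\<close>

definition bool_function :: "'a form \<Rightarrow> nat \<Rightarrow> nat list \<Rightarrow> (nat list \<Rightarrow> nat) \<Rightarrow> 'a deriv" where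
  "bool_function A m ks f = LolliR (decision A m (rev ks) (\<lambda>xs. f (rev xs)))"

lemma bool_function: "bool_function A m ks f \<triangleright> map (\<lambda>k. boolean k A) ks \<turnstile> boolean m A"
  unfolding bool_function_def boolean_def[of m]
  using LolliR[OF decision, of A m "rev ks"] by simp

lemma fold_Cut_bool_function:
  assumes "list_all2 (<) xs ks"
  shows "fold (Cut 0) (map2 (\<lambda>k. bool_val k A) ks xs) (bool_function A m ks f)
    \<approx> bool_val m A (f xs) \<triangleright> [] \<turnstile> boolean m A"
proof -
  let ?vs = "map2 (\<lambda>k. bool_val k A) ks xs" and ?f = "\<lambda>xs. f (rev xs)"
  have "closed ?vs (map (\<lambda>k. boolean k A) ks)"
    using list_all2_lengthD[OF assms] by (simp add: list_all2_conv_all_nth bool_val)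
  moreover have "decision A m (rev ks) ?f \<triangleright> with_power A m # map (\<lambda>k. boolean k A) ks \<turnstile> A"
    using decision[of A m "rev ks"] by simp
  ultimately have "fold (Cut 0) ?vs (bool_function A m ks f)
      \<approx> LolliR (fold (Cut 1) ?vs (decision A m (rev ks) ?f)) \<triangleright> [] \<turnstile> boolean m A"
    unfolding bool_function_def boolean_def[of m] by (rule fold_Cut_LolliR)
  moreover have "LolliR (fold (Cut 1) ?vs (decision A m (rev ks) ?f)) \<approx> bool_val m A (f xs)
      \<triangleright> [] \<turnstile> boolean m A"
    unfolding bool_val_def[of m] boolean_def[of m]
    using fold_Cut_decision[of "rev xs" "rev ks" A m ?f] assms by (intro cong_LolliR) simp
  ultimately show ?thesis by (rule equiv_trans)
qed

text \<open>Only arities and functions on numbers enter here, so any family of functions with common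
  boolean inputs is covered; the machine is one instance.\<close>

lemma component_wise_plain_bool_functions:
  assumes "ks \<noteq> []" "ms \<noteq> []" and len: "length fs = length ms"
  obtains \<psi> where
    "\<psi> \<triangleright> [big_tensor (map Bang (map (\<lambda>k. boolean k A) ks))]
      \<turnstile> big_tensor (map Bang (map (\<lambda>m. boolean m A) ms))"
    "component_wise_plain_tensor (map (\<lambda>k. boolean k A) ks) (map (\<lambda>m. boolean m A) ms) \<psi>"
    "\<And>xs. list_all2 (<) xs ks \<Longrightarrow>
      Cut 0 (big_TensR (map Prom (map2 (\<lambda>k. bool_val k A) ks xs))) \<psi>
        \<approx> big_TensR (map Prom (map2 (\<lambda>m f. bool_val m A (f xs)) ms fs))
        \<triangleright> [] \<turnstile> big_tensor (map Bang (map (\<lambda>m. boolean m A) ms))"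
proof -
  let ?\<pi>s = "map2 (\<lambda>m. bool_function A m ks) ms fs"
  have \<pi>s: "list_all2 (\<lambda>\<pi> B. \<pi> \<triangleright> map (\<lambda>k. boolean k A) ks \<turnstile> B) ?\<pi>s (map (\<lambda>m. boolean m A) ms)"
    using len by (auto simp: list_all2_conv_all_nth bool_function)
  obtain \<psi> where \<psi>: "\<psi> \<triangleright> [big_tensor (map Bang (map (\<lambda>k. boolean k A) ks))]
      \<turnstile> big_tensor (map Bang (map (\<lambda>m. boolean m A) ms))"
    "component_wise_plain_tensor (map (\<lambda>k. boolean k A) ks) (map (\<lambda>m. boolean m A) ms) \<psi>"
    and step: "\<And>vs ws. closed vs (map (\<lambda>k. boolean k A) ks) \<Longrightarrow>
      list_all2 (\<lambda>(\<pi>, w) B. fold (Cut 0) vs \<pi> \<approx> w \<triangleright> [] \<turnstile> B) (zip ?\<pi>s ws) (map (\<lambda>m. boolean m A) ms) \<Longrightarrow>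
      length ws = length ?\<pi>s \<Longrightarrow>
      Cut 0 (big_TensR (map Prom vs)) \<psi> \<approx> big_TensR (map Prom ws)
        \<triangleright> [] \<turnstile> big_tensor (map Bang (map (\<lambda>m. boolean m A) ms))"
    using component_wise_plain_tensor_linear[OF \<pi>s] assms by auto
  show thesis
  proof (rule that[OF \<psi>])
    fix xs assume xs: "list_all2 (<) xs ks"
    show "Cut 0 (big_TensR (map Prom (map2 (\<lambda>k. bool_val k A) ks xs))) \<psi>
        \<approx> big_TensR (map Prom (map2 (\<lambda>m f. bool_val m A (f xs)) ms fs))
        \<triangleright> [] \<turnstile> big_tensor (map Bang (map (\<lambda>m. boolean m A) ms))"
      using len list_all2_lengthD[OF xs] fold_Cut_bool_function[OF xs]
      by (intro step) (auto simp: list_all2_conv_all_nth bool_val)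
  qed
qed

section \<open>The transition step\<close>

theorem proposition5p11:
  fixes n s h :: nat
    and \<delta> :: "nat \<times> nat \<Rightarrow> nat \<times> nat \<times> direction"
    and A :: "'a form"
  assumes "n \<ge> 1" and "s \<ge> 1" and "h \<ge> 1"
    and "\<And>\<sigma> q. \<sigma> < s \<Longrightarrow> q < n \<Longrightarrow> \<delta> (\<sigma>, q) \<in> {..<s} \<times> {..<n} \<times> UNIV"
  shows "\<exists>absstep.
    absstep \<triangleright> [config_formula s n h A] \<turnstile> config_formula s n h A \<and>
    component_wise_plain_tensor (config_types s n h A) (config_types s n h A) absstep \<and>
    (\<forall>\<sigma> q i \<sigma>' q' d. (\<forall>j<h. \<sigma> j < s) \<longrightarrow> q < n \<longrightarrow> i < h \<longrightarrow> \<delta> (\<sigma> i, q) = (\<sigma>', q', d) \<longrightarrow>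
       Cut 0 (config_proof s n h A \<sigma> q i) absstep
         \<approx> config_proof s n h A (\<sigma>(i := \<sigma>')) q' (move h d i)
         \<triangleright> [] \<turnstile> config_formula s n h A)"
proof -
  let ?ks = "replicate h s @ [n, h]"
  \<comment> \<open>In an input list \<open>xs\<close> the indices below \<open>h\<close> are tape
    squares, \<open>h\<close> is the state and \<open>Suc h\<close> the head position, so
    \<open>xs ! (xs ! Suc h)\<close> is the scanned symbol.\<close>
  let ?out = "\<lambda>xs. \<delta> (xs ! (xs ! Suc h), xs ! h)"
  let ?fs = "map (\<lambda>j xs. if j = xs ! Suc h then fst (?out xs) else xs ! j) [0..<h]
    @ [\<lambda>xs. fst (snd (?out xs)), \<lambda>xs. move h (snd (snd (?out xs))) (xs ! Suc h)]"
  have types: "map (\<lambda>k. boolean k A) ?ks = config_types s n h A"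
    by (simp add: config_types_def)
  obtain \<psi> where \<psi>: "\<psi> \<triangleright> [config_formula s n h A] \<turnstile> config_formula s n h A"
    "component_wise_plain_tensor (config_types s n h A) (config_types s n h A) \<psi>"
    and step: "\<And>xs. list_all2 (<) xs ?ks \<Longrightarrow>
      Cut 0 (big_TensR (map Prom (map2 (\<lambda>k. bool_val k A) ?ks xs))) \<psi>
        \<approx> big_TensR (map Prom (map2 (\<lambda>m f. bool_val m A (f xs)) ?ks ?fs)) \<triangleright> [] \<turnstile> config_formula s n h A"
    using component_wise_plain_bool_functions[of ?ks ?ks ?fs A]
    unfolding types config_formula_def by auto
  have "Cut 0 (config_proof s n h A \<sigma> q i) \<psi> \<approx> config_proof s n h A (\<sigma>(i := \<sigma>')) q' (move h d i)
      \<triangleright> [] \<turnstile> config_formula s n h A"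
    if "\<forall>j<h. \<sigma> j < s" "q < n" "i < h" "\<delta> (\<sigma> i, q) = (\<sigma>', q', d)" for \<sigma> q i \<sigma>' q' d
  proof -
    let ?xs = "map \<sigma> [0..<h] @ [q, i]"
    \<comment> \<open>The type \<open>'b\<close> is left general because \<open>f\<close> lists
      symbols in one use and component functions in the other.\<close>
    have zip: "map2 g (replicate h s) (map f [0..<h]) = map (\<lambda>j. g s (f j)) [0..<h]"
      for g :: "nat \<Rightarrow> 'b \<Rightarrow> 'a deriv" and f :: "nat \<Rightarrow> 'b"
      by (rule nth_equalityI) simp_all
    have "list_all2 (<) ?xs ?ks"
    proof (rule list_all2_appendI)
      show "list_all2 (<) (map \<sigma> [0..<h]) (replicate h s)"
        using that by (simp add: list_all2_conv_all_nth)
    qed (use that in simp)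
    moreover have "map2 (\<lambda>k. bool_val k A) ?ks ?xs
        = map (\<lambda>j. bool_val s A (\<sigma> j)) [0..<h] @ [bool_val n A q, bool_val h A i]"
      by (simp add: zip)
    \<comment> \<open>Since \<open>i < h\<close>, the lookup at the head position stays within the
      tape part of \<open>?xs\<close> and yields \<open>\<sigma> i\<close>, so the given value of
      \<open>\<delta>\<close> settles every component.\<close>
    moreover have "map2 (\<lambda>m f. bool_val m A (f ?xs)) ?ks ?fs
        = map (\<lambda>j. bool_val s A ((\<sigma>(i := \<sigma>')) j)) [0..<h] @ [bool_val n A q', bool_val h A (move h d i)]"
      using that by (simp add: zip nth_append)
    ultimately show ?thesis using step[of ?xs] by (simp only: config_proof_def)
  qed
  with \<psi> show ?thesis by blast
qed

end
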